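(* Let $X$ be a nonzero complex Banach space with open unit ball $\mathbb{B}$, let $0\le\alpha<1$, and let $F:\mathbb{B}\to X$ be a locally biholomorphic mapping satisfying $$\frac{D^{k+1}F(0)(x^{k+1})}{(k+1)!}=H_{F,k}(x)\,x,\qquad x\in X,\quad k=1,2,3,$$ where each $H_{F,k}$ is a homogeneous polynomial of degree $k$ on $X$ with values in $\mathbb{C}$. If $F\in\mathcal{S}^*_{\mathbb{B}}(\alpha)$, then for every $x_0\in X$ with $\|x_0\|=1$ and every $T_{x_0}\in T(x_0)$, $$|H_{2,2}(F)|=|A_2A_4-A_3^2|\le(1-\alpha)^2 .$$ Moreover, the estimate is sharp: for every nonzero complex Banach space $X$ and every $0\le\alpha<1$ there are a locally biholomorphic mapping $F\in\mathcal{S}^*_{\mathbb{B}}(\alpha)$ with $\frac{D^{k+1}F(0)(x^{k+1})}{(k+1)!}=H_{F,k}(x)\,x$ for all $x\in X$ and $k=1,2,3$, where each $H_{F,k}$ is a $\mathbb{C}$-valued homogeneous polynomial of degree $k$ on $X$, a unit vector $x_0$ and $T_{x_0}\in T(x_0)$ for which equality $|A_2A_4-A_3^2|=(1-\alpha)^2$ holds.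
   Context: $X$ is a complex Banach space with norm $\|\cdot\|$ and $\mathbb{B}=\{x\in X:\|x\|<1\}$. For $x\in X\setminus\{0\}$, $T(x)$ is the (nonempty) set of bounded linear functionals $T_x:X\to\mathbb{C}$ with $\|T_x\|=1$ and $T_x(x)=\|x\|$. For holomorphic $F:\mathbb{B}\to X$, $DF(x)$ is the Fréchet derivative at $x$, $D^nF(x)$ is the $n$th Fréchet derivative (a bounded symmetric $n$-linear map $X^n\to X$), and $D^nF(0)(x^n)=D^nF(0)(x,\ldots,x)$. $F$ is normalized if $F(0)=0$ and $DF(0)=I$ (the identity), and locally biholomorphic if it is holomorphic and $DF(x)$ is invertible with bounded inverse for every $x\in\mathbb{B}$. Class $\mathcal{S}^*_{\mathbb{B}}(\alpha)$ (starlike mappings of order $\alpha$): for $0<\alpha<1$, the set of normalized locally biholomorphic $F:\mathbb{B}\to X$ such that $$\left|\frac{1}{\|x\|}T_x\big((DF(x))^{-1}F(x)\big)-\frac{1}{2\alpha}\right|<\frac{1}{2\alpha}\quad\text{for all }x\in\mathbb{B}\setminus\{0\},\ T_x\in T(x);$$ equivalently, $\operatorname{Re}\big(\|x\|/T_x((DF(x))^{-1}F(x))\big)>\alpha$ for all such $x,T_x$. For $\alpha=0$, $\mathcal{S}^*_{\mathbb{B}}(0)=\mathcal{S}^*_{\mathbb{B}}$ is the set of normalized locally biholomorphic $F$ with $\operatorname{Re}\,T_x((DF(x))^{-1}F(x))>0$ for all $x\in\mathbb{B}\setminus\{0\}$, $T_x\in T(x)$. Given $x_0$ with $\|x_0\|=1$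 and $T_{x_0}\in T(x_0)$, put $A_n=\frac{1}{n!}T_{x_0}\big(D^nF(0)(x_0^n)\big)$ for $n=2,3,4$. *)

theory Defs
  imports "HOL-Analysis.Analysis"
begin

text \<open>The distribution has no complex normed spaces. A complex Banach space is a real one whose
  real scalar multiplication extends to a complex one that is compatible with the norm.\<close>

class complex_banach = banach +
  fixes scaleC :: "complex \<Rightarrow> 'a \<Rightarrow> 'a" (infixr "*\<^sub>C" 75)
  assumes scaleC_add_right: "c *\<^sub>C (x + y) = c *\<^sub>C x + c *\<^sub>C y"
    and scaleC_add_left: "(c + d) *\<^sub>C x = c *\<^sub>C x + d *\<^sub>C x"
    and scaleC_scaleC: "c *\<^sub>C (d *\<^sub>C x) = (c * d) *\<^sub>C x"
    and scaleR_scaleC: "scaleR r x = complex_of_real r *\<^sub>C x"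
    and norm_scaleC: "norm (c *\<^sub>C x) = cmod c * norm x"

instantiation complex :: complex_banach
begin

definition scaleC_complex :: "complex \<Rightarrow> complex \<Rightarrow> complex"
  where "scaleC_complex c x = c * x"

instance
  by standard
    (simp_all add: scaleC_complex_def algebra_simps scaleR_conv_of_real norm_mult)

end

definition complex_linear :: "('a::complex_banach \<Rightarrow> 'b::complex_banach) \<Rightarrow> bool"
  where "complex_linear f \<longleftrightarrow>
    (\<forall>x y. f (x + y) = f x + f y) \<and> (\<forall>c x. f (c *\<^sub>C x) = c *\<^sub>C f x)"

text \<open>The set \<open>T(x)\<close>. The norm of a bounded linear function is its operator norm, which does not
  depend on whether the scalars are real or complex.\<close>

definition support_functionals :: "'a::complex_banach \<Rightarrow> ('a \<Rightarrow>\<^sub>L complex) set"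
  where "support_functionals x =
    {T. complex_linear (blinfun_apply T) \<and> norm T = 1 \<and> blinfun_apply T x = of_real (norm x)}"

text \<open>A continuous homogeneous polynomial of degree \<open>k\<close> is the restriction to the diagonal of a
  bounded \<open>k\<close>-linear map. The \<open>k\<close> arguments of that map are passed as a list; its values on lists
  of any other length are irrelevant.\<close>

definition bounded_multilinear :: "nat \<Rightarrow> ('a::complex_banach list \<Rightarrow> complex) \<Rightarrow> bool"
  where "bounded_multilinear k L \<longleftrightarrow>
    (\<forall>xs i. length xs = k \<and> i < k \<longrightarrow> complex_linear (\<lambda>y. L (xs[i := y]))) \<and>
    (\<exists>C. \<forall>xs. length xs = k \<longrightarrow> cmod (L xs) \<le> C * prod_list (map norm xs))"

definition homogeneous_polynomial :: "nat \<Rightarrow> ('a::complex_banach \<Rightarrow> complex) \<Rightarrow> bool"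
  where "homogeneous_polynomial k P \<longleftrightarrow>
    (\<exists>L. bounded_multilinear k L \<and> (\<forall>x. P x = L (replicate k x)))"

text \<open>Mappings of the open unit ball are total functions whose values off the ball play no role:
  below, derivatives are taken only at points of the ball.\<close>

definition holomorphic_ball :: "('a::complex_banach \<Rightarrow> 'a) \<Rightarrow> bool"
  where "holomorphic_ball F \<longleftrightarrow>
    (\<forall>x\<in>ball 0 1. \<exists>D. (F has_derivative D) (at x) \<and> complex_linear D)"

text \<open>The Frechet derivative as a map into the Banach space of bounded linear operators, so that it
  can be iterated. The type uses real scalars; where a complex derivative exists, the real one
  coincides with it.\<close>

definition frechet ::
    "('a::real_normed_vector \<Rightarrow> 'b::real_normed_vector) \<Rightarrow> 'a \<Rightarrow> ('a \<Rightarrow>\<^sub>L 'b)"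
  where "frechet F x = Blinfun (frechet_derivative F (at x))"

text \<open>\<open>D\<^sup>nF(a)(x\<^sup>n)\<close>. The type of the iterated derivative depends on its order, hence one
  definition per order.\<close>

definition frechet_diag2 :: "('a::complex_banach \<Rightarrow> 'a) \<Rightarrow> 'a \<Rightarrow> 'a \<Rightarrow> 'a"
  where "frechet_diag2 F a x =
    blinfun_apply (blinfun_apply (frechet (frechet F) a) x) x"

definition frechet_diag3 :: "('a::complex_banach \<Rightarrow> 'a) \<Rightarrow> 'a \<Rightarrow> 'a \<Rightarrow> 'a"
  where "frechet_diag3 F a x =
    blinfun_apply (blinfun_apply (blinfun_apply (frechet (frechet (frechet F)) a) x) x) x"

definition frechet_diag4 :: "('a::complex_banach \<Rightarrow> 'a) \<Rightarrow> 'a \<Rightarrow> 'a \<Rightarrow> 'a"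
  where "frechet_diag4 F a x =
    blinfun_apply (blinfun_apply (blinfun_apply (blinfun_apply
      (frechet (frechet (frechet (frechet F))) a) x) x) x) x"

definition normalized :: "('a::complex_banach \<Rightarrow> 'a) \<Rightarrow> bool"
  where "normalized F \<longleftrightarrow> F 0 = 0 \<and> frechet F 0 = id_blinfun"

definition locally_biholomorphic :: "('a::complex_banach \<Rightarrow> 'a) \<Rightarrow> bool"
  where "locally_biholomorphic F \<longleftrightarrow>
    holomorphic_ball F \<and>
    (\<forall>x\<in>ball 0 1. \<exists>G. G o\<^sub>L frechet F x = id_blinfun \<and> frechet F x o\<^sub>L G = id_blinfun)"

definition inv_deriv_apply :: "('a::complex_banach \<Rightarrow> 'a) \<Rightarrow> 'a \<Rightarrow> 'a"
  where "inv_deriv_apply F x = inv (blinfun_apply (frechet F x)) (F x)"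

definition starlike_order :: "real \<Rightarrow> ('a::complex_banach \<Rightarrow> 'a) set"
  where "starlike_order \<alpha> =
    {F. normalized F \<and> locally_biholomorphic F \<and>
        (\<forall>x\<in>ball 0 1 - {0}. \<forall>T\<in>support_functionals x.
          if \<alpha> = 0 then Re (blinfun_apply T (inv_deriv_apply F x)) > 0
          else cmod (1 / of_real (norm x) * blinfun_apply T (inv_deriv_apply F x)
                      - 1 / (2 * of_real \<alpha>)) < 1 / (2 * \<alpha>))}"

text \<open>The Taylor terms of orders 2, 3, 4 at the origin are scalar multiples of the identity.\<close>

definition scalar_type_terms :: "('a::complex_banach \<Rightarrow> 'a) \<Rightarrow> bool"
  where "scalar_type_terms F \<longleftrightarrow>
    (\<exists>H :: nat \<Rightarrow> 'a \<Rightarrow> complex.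
      (\<forall>k\<in>{1, 2, 3}. homogeneous_polynomial k (H k)) \<and>
      (\<forall>x. (1 / fact 2) *\<^sub>R frechet_diag2 F 0 x = H 1 x *\<^sub>C x) \<and>
      (\<forall>x. (1 / fact 3) *\<^sub>R frechet_diag3 F 0 x = H 2 x *\<^sub>C x) \<and>
      (\<forall>x. (1 / fact 4) *\<^sub>R frechet_diag4 F 0 x = H 3 x *\<^sub>C x))"

definition A2 :: "('a::complex_banach \<Rightarrow> 'a) \<Rightarrow> 'a \<Rightarrow> ('a \<Rightarrow>\<^sub>L complex) \<Rightarrow> complex"
  where "A2 F x0 T = 1 / fact 2 * blinfun_apply T (frechet_diag2 F 0 x0)"

definition A3 :: "('a::complex_banach \<Rightarrow> 'a) \<Rightarrow> 'a \<Rightarrow> ('a \<Rightarrow>\<^sub>L complex) \<Rightarrow> complex"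
  where "A3 F x0 T = 1 / fact 3 * blinfun_apply T (frechet_diag3 F 0 x0)"

definition A4 :: "('a::complex_banach \<Rightarrow> 'a) \<Rightarrow> 'a \<Rightarrow> ('a \<Rightarrow>\<^sub>L complex) \<Rightarrow> complex"
  where "A4 F x0 T = 1 / fact 4 * blinfun_apply T (frechet_diag4 F 0 x0)"

end

theory Submission
  imports Defs "HOL-Complex_Analysis.Complex_Analysis"
begin

text \<open>Put \<open>h(x) = DF(x)\<^sup>-\<^sup>1F(x)\<close> and \<open>p(z) = T(h(z x\<^sub>0)) / z\<close>. Since the Taylor terms of \<open>F\<close> up to order 4
  are scalar multiples of the identity, \<open>F(z x\<^sub>0)\<close> and \<open>DF(z x\<^sub>0)x\<^sub>0\<close> are multiples of \<open>x\<^sub>0\<close> up to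
  \<open>O(z\<^sup>5)\<close> and \<open>O(z\<^sup>4)\<close>, so the \<open>A\<^sub>n\<close> are related to the coefficients of \<open>p\<close> as for
  \<open>z f'/f = 1/p\<close> in one variable. Starlikeness of order \<open>\<alpha> = 1 - \<beta>\<close> says that
  \<open>(1 - p) / (1 + (2 \<beta> - 1) p) = b\<^sub>1z + b\<^sub>2z\<^sup>2 + b\<^sub>3z\<^sup>3 + \<dots>\<close> is a Schwarz function, and then
  \<open>3 (A\<^sub>2A\<^sub>4 - A\<^sub>3\<^sup>2) = \<beta>\<^sup>2 (4b\<^sub>1b\<^sub>3 + 2b\<^sub>1\<^sup>2b\<^sub>2 - 3b\<^sub>2\<^sup>2 + (1 - 4\<beta>\<^sup>2)b\<^sub>1\<^sup>4)\<close>; the Schur parameters of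
  the Schwarz function bound the last factor by 3. Equality holds for
  \<open>F(x) = (1 - l(x)\<^sup>2)\<^sup>-\<^sup>\<beta> x\<close> with a support functional \<open>l\<close> of \<open>x\<^sub>0\<close>.\<close>

section \<open>Complex Banach spaces\<close>

lemma scaleC_zero_right [simp]: "c *\<^sub>C (0 :: 'a::complex_banach) = 0"
  using norm_scaleC[of c "0 :: 'a"] by simp

lemma scaleC_zero_left [simp]: "0 *\<^sub>C (x :: 'a::complex_banach) = 0"
  using norm_scaleC[of 0 x] by simp

lemma scaleC_one [simp]: "1 *\<^sub>C (x :: 'a::complex_banach) = x"
  using scaleR_scaleC[of 1 x] by simp

lemma bounded_bilinear_scaleC:
  "bounded_bilinear (\<lambda>c (x :: 'a::complex_banach). c *\<^sub>C x)"
proof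
  show "(r *\<^sub>R c) *\<^sub>C x = r *\<^sub>R c *\<^sub>C x" for r c and x :: 'a
    unfolding scaleR_conv_of_real[of r c] by (simp only: scaleR_scaleC scaleC_scaleC)
  show "c *\<^sub>C r *\<^sub>R x = r *\<^sub>R c *\<^sub>C x" for r c and x :: 'a
    by (simp add: scaleR_scaleC scaleC_scaleC mult.commute)
  show "\<exists>K. \<forall>c (x :: 'a). norm (c *\<^sub>C x) \<le> norm c * norm x * K"
    by (rule exI[of _ 1]) (simp add: norm_scaleC)
qed (simp_all add: scaleC_add_left scaleC_add_right)

interpretation scaleC: bounded_bilinear "\<lambda>c (x :: 'a::complex_banach). c *\<^sub>C x"
  by (rule bounded_bilinear_scaleC)

lemma scaleC_minus_one [simp]: "(- 1) *\<^sub>C (x :: 'a::complex_banach) = - x"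
  by (simp add: scaleC.minus_left)

lemma complex_linearD:
  assumes "complex_linear f"
  shows "f (x + y) = f x + f y" "f (c *\<^sub>C x) = c *\<^sub>C f x"
    "f 0 = 0" "f (- x) = - f x" "f (x - y) = f x - f y" "f (r *\<^sub>R x) = r *\<^sub>R f x"
proof -
  show add: "f (x + y) = f x + f y" for x y
    using assms by (simp add: complex_linear_def)
  show sc: "f (c *\<^sub>C x) = c *\<^sub>C f x" for c x
    using assms by (simp add: complex_linear_def)
  show "f 0 = 0"
    using sc[of 0 0] by simp
  show minus: "f (- x) = - f x" for x
    using sc[of "-1" x] by simp
  show "f (x - y) = f x - f y"
    using add[of x "- y"] minus by simp
  show "f (r *\<^sub>R x) = r *\<^sub>R f x"
    by (simp add: scaleR_scaleC sc)
qed

instantiation blinfun :: (real_normed_vector, complex_banach) complex_banach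
begin

definition scaleC_blinfun :: "complex \<Rightarrow> 'a \<Rightarrow>\<^sub>L 'b \<Rightarrow> 'a \<Rightarrow>\<^sub>L 'b"
  where "scaleC_blinfun c f = Blinfun (\<lambda>x. c *\<^sub>C blinfun_apply f x)"

lemma blinfun_apply_scaleC [simp]:
  "blinfun_apply (c *\<^sub>C f) x = c *\<^sub>C blinfun_apply f x"
  unfolding scaleC_blinfun_def
  by (subst bounded_linear_Blinfun_apply)
    (auto intro: bounded_linear_compose[OF scaleC.bounded_linear_right] blinfun.bounded_linear_right)

instance
proof
  fix c :: complex and f :: "'a \<Rightarrow>\<^sub>L 'b"
  have le: "norm (c *\<^sub>C f) \<le> cmod c * norm f" for c and f :: "'a \<Rightarrow>\<^sub>L 'b"
    by (rule norm_blinfun_bound)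
      (auto simp: norm_scaleC mult.assoc intro!: mult_left_mono norm_blinfun)
  show "norm (c *\<^sub>C f) = cmod c * norm f"
  proof (cases "c = 0")
    case True
    then show ?thesis using le[of 0 f] by simp
  next
    case False
    have "f = inverse c *\<^sub>C (c *\<^sub>C f)"
      using False by (intro blinfun_eqI) (simp add: scaleC_scaleC)
    then have "norm f \<le> inverse (cmod c) * norm (c *\<^sub>C f)"
      by (metis le norm_inverse)
    then show ?thesis
      using le[of c f] False by (simp add: field_simps)
  qed
qed (auto intro!: blinfun_eqI simp: blinfun.bilinear_simps scaleC_add_left scaleC_add_right
       scaleC_scaleC scaleR_scaleC)

end

section \<open>Support functionals\<close>

definition sublinear :: "('a::real_vector \<Rightarrow> real) \<Rightarrow> bool"
  where "sublinear q \<longleftrightarrow> (\<forall>x y. q (x + y) \<le> q x + q y) \<and> (\<forall>x. \<forall>t\<ge>0. q (t *\<^sub>R x) = t * q x)"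

lemma sublinearD:
  assumes "sublinear q"
  shows "q (x + y) \<le> q x + q y" "t \<ge> 0 \<Longrightarrow> q (t *\<^sub>R x) = t * q x" "q 0 = 0" "- q (- x) \<le> q x"
proof -
  show add: "q (x + y) \<le> q x + q y" for x y
    using assms by (simp add: sublinear_def)
  show sc: "t \<ge> 0 \<Longrightarrow> q (t *\<^sub>R x) = t * q x" for t x
    using assms by (simp add: sublinear_def)
  show z: "q 0 = 0"
    using sc[of 0 0] by simp
  show "- q (- x) \<le> q x"
    using add[of x "- x"] z by simp
qed

text \<open>Hahn--Banach without extension from subspaces: a sublinear functional that is minimal for the
  pointwise order equals each of its minorants \<open>directional q a\<close>, which forces additivity.\<close>

definition directional :: "('a::real_vector \<Rightarrow> real) \<Rightarrow> 'a \<Rightarrow> 'a \<Rightarrow> real"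
  where "directional q a y = (INF t\<in>{0..}. q (y + t *\<^sub>R a) - t * q a)"

lemma directional:
  assumes q: "sublinear q"
  shows "sublinear (directional q a)" "directional q a y \<le> q y"
    "t \<ge> 0 \<Longrightarrow> directional q a y \<le> q (y + t *\<^sub>R a) - t * q a"
proof -
  note q = sublinearD[OF q]
  have low: "- q (- y) \<le> q (y + t *\<^sub>R a) - t * q a" if "t \<ge> 0" for t y
    using q(1)[of "y + t *\<^sub>R a" "- y"] q(2)[OF that, of a] by simp
  have bdd: "bdd_below ((\<lambda>t. q (y + t *\<^sub>R a) - t * q a) ` {0..})" for y
    using low by (intro bdd_belowI2[of _ "- q (- y)"]) auto
  have le: "directional q a y \<le> q (y + t *\<^sub>R a) - t * q a" if "t \<ge> 0" for t y
    unfolding directional_def using that by (intro cINF_lower bdd) auto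
  have ge: "c \<le> directional q a y" if "\<And>t. t \<ge> 0 \<Longrightarrow> c \<le> q (y + t *\<^sub>R a) - t * q a" for c y
    unfolding directional_def using that by (intro cINF_greatest) auto
  show "directional q a y \<le> q y"
    using le[of 0 y] by simp
  show "t \<ge> 0 \<Longrightarrow> directional q a y \<le> q (y + t *\<^sub>R a) - t * q a"
    by (rule le)
  have add: "directional q a (x + y) \<le> directional q a x + directional q a y" for x y
  proof -
    have "directional q a (x + y) - (q (y + s *\<^sub>R a) - s * q a) \<le> directional q a x"
      if s: "s \<ge> 0" for s
    proof (rule ge)
      fix t :: real assume t: "t \<ge> 0"
      have "directional q a (x + y) \<le> q (x + y + (t + s) *\<^sub>R a) - (t + s) * q a"
        using s t by (intro le) auto
      also have "x + y + (t + s) *\<^sub>R a = (x + t *\<^sub>R a) + (y + s *\<^sub>R a)"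
        by (simp add: algebra_simps)
      finally show "directional q a (x + y) - (q (y + s *\<^sub>R a) - s * q a) \<le> q (x + t *\<^sub>R a) - t * q a"
        using q(1)[of "x + t *\<^sub>R a" "y + s *\<^sub>R a"] by (simp add: algebra_simps)
    qed
    then have "directional q a (x + y) - directional q a x \<le> directional q a y"
      by (intro ge) (simp add: algebra_simps)
    then show ?thesis by simp
  qed
  have sc_le: "directional q a (s *\<^sub>R y) \<le> s * directional q a y" if "s > 0" for s y
  proof -
    have "directional q a (s *\<^sub>R y) / s \<le> directional q a y"
    proof (rule ge)
      fix t :: real assume t: "t \<ge> 0"
      have "directional q a (s *\<^sub>R y) \<le> q (s *\<^sub>R y + (s * t) *\<^sub>R a) - (s * t) * q a"
        using that t by (intro le) auto
      also have "s *\<^sub>R y + (s * t) *\<^sub>R a = s *\<^sub>R (y + t *\<^sub>R a)"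
        by (simp add: algebra_simps)
      also have "q \<dots> = s * q (y + t *\<^sub>R a)"
        using that by (intro q) auto
      finally show "directional q a (s *\<^sub>R y) / s \<le> q (y + t *\<^sub>R a) - t * q a"
        using that by (simp add: field_simps)
    qed
    then show ?thesis using that by (simp add: field_simps)
  qed
  have zero: "directional q a 0 = 0"
    using le[of 0 0] low[of _ 0] q(3) by (intro antisym ge) auto
  have sc: "directional q a (s *\<^sub>R y) = s * directional q a y" if "s \<ge> 0" for s y
  proof (cases "s = 0")
    case True
    then show ?thesis by (simp add: zero)
  next
    case False
    then have s: "s > 0" using that by simp
    have "directional q a (inverse s *\<^sub>R (s *\<^sub>R y)) \<le> inverse s * directional q a (s *\<^sub>R y)"
      using s by (intro sc_le) auto
    then have "s * directional q a y \<le> directional q a (s *\<^sub>R y)"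
      using s by (simp add: field_simps)
    then show ?thesis using sc_le[OF s, of y] by simp
  qed
  show "sublinear (directional q a)"
    unfolding sublinear_def using add sc by blast
qed

lemma ex_minimal_sublinear:
  fixes p :: "'a::real_vector \<Rightarrow> real"
  assumes p: "sublinear p"
  obtains q where "sublinear q" "q \<le> p" "\<And>r. sublinear r \<Longrightarrow> r \<le> q \<Longrightarrow> r = q"
proof -
  define A where "A = {q. sublinear q \<and> q \<le> p}"
  have "\<exists>m\<in>A. \<forall>a\<in>A. a \<le> m \<longrightarrow> a = m"
  proof (rule predicate_Zorn)
    show "partial_order_on A (relation_of (\<lambda>x y. y \<le> x) A)"
      by (rule partial_order_on_relation_ofI) auto
    fix C assume C: "C \<in> Chains (relation_of (\<lambda>x y. y \<le> x) A)"
    have CA: "C \<subseteq> A" and tot: "\<And>a b. a \<in> C \<Longrightarrow> b \<in> C \<Longrightarrow> a \<le> b \<or> b \<le> a"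
      using C unfolding Chains_def relation_of_def by auto
    show "\<exists>u\<in>A. \<forall>a\<in>C. u \<le> a"
    proof (cases "C = {}")
      case True
      then show ?thesis using p by (auto simp: A_def)
    next
      case False
      define u where "u y = (INF q\<in>C. q y)" for y
      have sub: "sublinear q" and qp: "q y \<le> p y" if "q \<in> C" for q y
        using CA that by (auto simp: A_def le_fun_def)
      have "- p (- y) \<le> q y" if "q \<in> C" for q y
        using sublinearD(4)[OF sub[OF that], of y] qp[OF that, of "- y"] by simp
      then have bdd: "bdd_below ((\<lambda>q. q y) ` C)" for y
        by (intro bdd_belowI2[of _ "- p (- y)"])
      have le: "u y \<le> q y" if "q \<in> C" for q y
        unfolding u_def using that by (intro cINF_lower bdd) auto
      have ge: "c \<le> u y" if "\<And>q. q \<in> C \<Longrightarrow> c \<le> q y" for c y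
        unfolding u_def using that False by (intro cINF_greatest) auto
      have "u (x + y) \<le> u x + u y" for x y
      proof -
        have "u (x + y) - q x \<le> u y" if q: "q \<in> C" for q
        proof (rule ge)
          fix r assume r: "r \<in> C"
          obtain s where s: "s \<in> C" "s \<le> q" "s \<le> r"
            using tot[OF q r] q r by blast
          have "u (x + y) \<le> s x + s y"
            using le[OF s(1), of "x + y"] sublinearD(1)[OF sub[OF s(1)], of x y] by simp
          also have "\<dots> \<le> q x + r y"
            using s by (intro add_mono) (auto simp: le_fun_def)
          finally show "u (x + y) - q x \<le> r y" by simp
        qed
        then have "u (x + y) - u y \<le> u x"
          by (intro ge) (simp add: algebra_simps)
        then show ?thesis by simp
      qed
      moreover have "u (t *\<^sub>R y) = t * u y" if "t \<ge> 0" for t y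
      proof (cases "t = 0")
        case True
        have "u 0 = 0"
          using INF_cong[OF refl, of C "\<lambda>q. q 0" "\<lambda>_. 0"] sublinearD(3)[OF sub] \<open>C \<noteq> {}\<close>
          by (simp add: u_def)
        then show ?thesis using True by simp
      next
        case False
        then have t: "t > 0" using that by simp
        have "u (t *\<^sub>R y) / t \<le> u y"
        proof (rule ge)
          fix q assume q: "q \<in> C"
          show "u (t *\<^sub>R y) / t \<le> q y"
            using le[OF q, of "t *\<^sub>R y"] sublinearD(2)[OF sub[OF q] that, of y] t
            by (simp add: field_simps)
        qed
        moreover have "t * u y \<le> u (t *\<^sub>R y)"
        proof (rule ge)
          fix q assume q: "q \<in> C"
          show "t * u y \<le> q (t *\<^sub>R y)"
            using le[OF q, of y] sublinearD(2)[OF sub[OF q] that, of y] t by simp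
        qed
        ultimately show ?thesis using t by (simp add: field_simps)
      qed
      ultimately have "sublinear u"
        unfolding sublinear_def by blast
      moreover have "u \<le> p"
        using False le qp by (metis all_not_in_conv le_fun_def order_trans)
      ultimately show ?thesis
        using le by (intro bexI[of _ u]) (auto simp: A_def le_fun_def)
    qed
  qed
  then show ?thesis
    using that unfolding A_def by (smt (verit, best) mem_Collect_eq order_trans)
qed

lemma minimal_sublinear_linear:
  fixes q :: "'a::real_vector \<Rightarrow> real"
  assumes q: "sublinear q" and min: "\<And>r. sublinear r \<Longrightarrow> r \<le> q \<Longrightarrow> r = q"
  shows "linear q"
proof -
  note q' = sublinearD[OF q]
  have add: "q (y + a) = q y + q a" for y a
  proof -
    have "directional q a = q"
      by (intro min directional le_funI q)
    then have "q y \<le> q (y + a) - q a"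
      using directional(3)[OF q, of 1 a y] by simp
    then show ?thesis
      using q'(1)[of y a] by simp
  qed
  have minus: "q (- x) = - q x" for x
    using add[of x "- x"] q'(3) by simp
  show ?thesis
  proof (rule linearI)
    show "q (r *\<^sub>R x) = r *\<^sub>R q x" for r x
    proof (cases "r \<ge> 0")
      case True
      then show ?thesis by (simp add: q')
    next
      case False
      then have "q ((- r) *\<^sub>R (- x)) = (- r) * q (- x)"
        by (intro q') auto
      then show ?thesis by (simp add: minus)
    qed
  qed (rule add)
qed

lemma ex_real_support_functional:
  fixes x :: "'a::real_normed_vector"
  obtains f where "linear f" "\<And>y. f y \<le> norm y" "f x = norm x"
proof -
  have n: "sublinear (norm :: 'a \<Rightarrow> real)"
    by (simp add: sublinear_def norm_triangle_ineq)
  obtain f where f: "sublinear f" "f \<le> directional norm x"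
    "\<And>r. sublinear r \<Longrightarrow> r \<le> f \<Longrightarrow> r = f"
    using ex_minimal_sublinear[OF directional(1)[OF n]] by metis
  have lin: "linear f"
    using f by (intro minimal_sublinear_linear)
  have le: "f y \<le> norm y" for y
    using f(2) directional(2)[OF n, of x y] by (meson le_fun_def order_trans)
  have "f (- x) \<le> - norm x"
    using f(2) directional(3)[OF n, of 1 x "- x"] by (simp add: le_fun_def) (meson order_trans)
  then have "f x = norm x"
    using le[of x] linear_neg[OF lin, of x] by simp
  then show ?thesis using that lin le by blast
qed

lemma ex_support_functional:
  fixes x :: "'a::complex_banach"
  assumes "x \<noteq> 0"
  obtains T where "T \<in> support_functionals x"
proof -
  obtain f :: "'a \<Rightarrow> real" where lin: "linear f" and le: "\<And>y. f y \<le> norm y" and fx: "f x = norm x"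
    using ex_real_support_functional by blast
  define T where "T y = complex_of_real (f y) - \<i> * complex_of_real (f (\<i> *\<^sub>C y))" for y
  have ReT: "Re (T y) = f y" for y
    by (simp add: T_def)
  have addT: "T (y + z) = T y + T z" for y z
    by (simp add: T_def linear_add[OF lin] scaleC_add_right algebra_simps)
  have iT: "T (\<i> *\<^sub>C y) = \<i> * T y" for y
    by (simp add: T_def scaleC_scaleC linear_neg[OF lin] algebra_simps)
  have rT: "T (r *\<^sub>R y) = of_real r * T y" for r y
    by (simp add: T_def scaleC.scaleR_right linear_cmul[OF lin] algebra_simps)
  have cT: "T (c *\<^sub>C y) = c * T y" for c y
  proof -
    have "c *\<^sub>C y = Re c *\<^sub>R y + Im c *\<^sub>R (\<i> *\<^sub>C y)"
      by (simp add: scaleR_scaleC scaleC_scaleC flip: scaleC_add_left)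
        (metis complex_eq mult.commute)
    then have "T (c *\<^sub>C y) = (of_real (Re c) + \<i> * of_real (Im c)) * T y"
      by (simp add: addT rT iT algebra_simps)
    then show ?thesis by (simp flip: complex_eq)
  qed
  have bd: "cmod (T y) \<le> norm y" for y
  proof (cases "T y = 0")
    case False
    define c where "c = cnj (T y) / of_real (cmod (T y))"
    have "c * T y = of_real (cmod (T y))"
      using False by (simp add: c_def complex_norm_square[symmetric] power2_eq_square mult.commute)
    then have "cmod (T y) = f (c *\<^sub>C y)"
      by (metis ReT cT Re_complex_of_real)
    also have "\<dots> \<le> norm (c *\<^sub>C y)"
      by (rule le)
    also have "\<dots> = norm y"
      using False by (simp add: norm_scaleC c_def norm_divide)
    finally show ?thesis .
  qed auto
  have Tx: "T x = of_real (norm x)"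
  proof (rule complex_eqI)
    have "(Re (T x))\<^sup>2 + (Im (T x))\<^sup>2 \<le> (norm x)\<^sup>2"
      using power_mono[OF bd[of x], of 2] by (simp add: cmod_power2)
    then show "Im (T x) = Im (of_real (norm x))"
      by (simp add: ReT fx)
  qed (simp add: ReT fx)
  have bl: "bounded_linear T"
    using bd by (intro bounded_linear_intro[of _ 1]) (auto simp: addT rT scaleR_conv_of_real)
  have app: "blinfun_apply (Blinfun T) = T"
    by (rule bounded_linear_Blinfun_apply[OF bl])
  have "norm (Blinfun T) \<le> 1"
    using bd by (intro norm_blinfun_bound) (auto simp: app)
  moreover have "norm x \<le> norm (Blinfun T) * norm x"
    using norm_blinfun[of "Blinfun T" x] by (simp add: app Tx)
  ultimately have "norm (Blinfun T) = 1"
    using assms by (simp add: mult_le_cancel_right1)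
  then have "Blinfun T \<in> support_functionals x"
    using Tx by (simp add: support_functionals_def app complex_linear_def addT cT scaleC_complex_def)
  then show ?thesis using that by blast
qed

section \<open>Holomorphic maps between complex Banach spaces\<close>

definition complex_differentiable_on ::
    "('a::complex_banach \<Rightarrow> 'b::complex_banach) \<Rightarrow> 'a set \<Rightarrow> bool"
  where "complex_differentiable_on F S \<longleftrightarrow>
    (\<forall>x\<in>S. \<exists>D. (F has_derivative D) (at x) \<and> complex_linear D)"

lemma complex_differentiable_on_subset:
  "complex_differentiable_on F S \<Longrightarrow> U \<subseteq> S \<Longrightarrow> complex_differentiable_on F U"
  by (auto simp: complex_differentiable_on_def)

lemma blinfun_apply_frechet:
  assumes "(F has_derivative D) (at x)"
  shows "blinfun_apply (frechet F x) = D"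
  unfolding frechet_def
  using assms frechet_derivative_at[OF assms]
  by (simp add: bounded_linear_Blinfun_apply has_derivative_bounded_linear)

lemma complex_differentiable_onD:
  assumes "complex_differentiable_on F S" "x \<in> S"
  shows "(F has_derivative blinfun_apply (frechet F x)) (at x)"
    "complex_linear (blinfun_apply (frechet F x))"
  using assms blinfun_apply_frechet unfolding complex_differentiable_on_def by metis+

lemma has_derivative_quadratic:
  fixes f :: "'a::real_normed_vector \<Rightarrow> 'b::real_normed_vector"
  assumes D: "bounded_linear D" and \<delta>: "\<delta> > 0"
    and le: "\<And>h. norm h < \<delta> \<Longrightarrow> norm (f (x + h) - f x - D h) \<le> C * (norm h)\<^sup>2"
  shows "(f has_derivative D) (at x)"
proof (rule has_derivativeI[OF D])
  show "((\<lambda>y. ((f y - f x) - D (y - x)) /\<^sub>R norm (y - x)) \<longlongrightarrow> 0) (at x)"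
  proof (rule Lim_null_comparison)
    have "norm (((f y - f x) - D (y - x)) /\<^sub>R norm (y - x)) \<le> C * norm (y - x)"
      if "y \<noteq> x" "dist y x < \<delta>" for y
    proof -
      have "norm ((f y - f x) - D (y - x)) \<le> C * norm (y - x) * norm (y - x)"
        using le[of "y - x"] that by (simp add: dist_norm power2_eq_square mult.assoc)
      then show ?thesis
        using that by (simp add: pos_divide_le_eq divide_inverse[symmetric] mult.commute[of "inverse _"])
    qed
    then show "\<forall>\<^sub>F y in at x. norm (((f y - f x) - D (y - x)) /\<^sub>R norm (y - x)) \<le> C * norm (y - x)"
      using \<delta> by (auto simp: eventually_at)
    show "((\<lambda>y. C * norm (y - x)) \<longlongrightarrow> 0) (at x)"
      by (auto intro!: tendsto_eq_intros)
  qed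
qed

lemma norm_le_functional:
  fixes y :: "'a::complex_banach"
  assumes "\<And>T. complex_linear (blinfun_apply T) \<Longrightarrow> norm T \<le> 1 \<Longrightarrow> cmod (blinfun_apply T y) \<le> C"
  shows "norm y \<le> C"
proof (cases "y = 0")
  case True
  have "complex_linear (blinfun_apply (0 :: 'a \<Rightarrow>\<^sub>L complex))"
    by (simp add: complex_linear_def)
  from assms[OF this] show ?thesis using True by simp
next
  case False
  then obtain T where "T \<in> support_functionals y"
    using ex_support_functional by blast
  then show ?thesis
    using assms[of T] by (auto simp: support_functionals_def)
qed

lemma has_derivative_slice:
  assumes F: "complex_differentiable_on F S" and S: "x + z *\<^sub>C v \<in> S"
  shows "((\<lambda>z. F (x + z *\<^sub>C v)) has_derivative
    (\<lambda>w. w *\<^sub>C blinfun_apply (frechet F (x + z *\<^sub>C v)) v)) (at z)"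
proof -
  have "((\<lambda>z. x + z *\<^sub>C v) has_derivative (\<lambda>w. w *\<^sub>C v)) (at z)"
    by (auto intro!: derivative_eq_intros scaleC.FDERIV simp: scaleC_add_left)
  from has_derivative_compose[OF this complex_differentiable_onD(1)[OF F S]]
  show ?thesis
    by (simp add: complex_linearD(2)[OF complex_differentiable_onD(2)[OF F S]])
qed

lemma has_field_derivative_functional:
  fixes T :: "'b::complex_banach \<Rightarrow>\<^sub>L complex"
  assumes f: "(f has_derivative (\<lambda>w. w *\<^sub>C d)) (at z)" and T: "complex_linear (blinfun_apply T)"
  shows "((\<lambda>z. blinfun_apply T (f z)) has_field_derivative blinfun_apply T d) (at z)"
proof -
  have "((\<lambda>z. blinfun_apply T (f z)) has_derivative (\<lambda>w. blinfun_apply T (w *\<^sub>C d))) (at z)"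
    by (rule bounded_linear.has_derivative[OF blinfun.bounded_linear_right f])
  then show ?thesis
    by (simp add: has_field_derivative_def complex_linearD(2)[OF T] scaleC_complex_def mult_commute_abs)
qed

lemma norm_deriv_le:
  assumes hol: "f holomorphic_on ball 0 R" and R: "R > 0"
    and bd: "\<And>z. z \<in> ball 0 R \<Longrightarrow> cmod (f z) \<le> M"
  shows "cmod (deriv f 0) \<le> 2 * M / R"
proof -
  have sub: "cball 0 (R / 2) \<subseteq> ball (0 :: complex) R"
    using R by auto
  have "cmod ((deriv ^^ 1) f 0) \<le> fact 1 * M / (R / 2) ^ 1"
    using R by (intro Cauchy_inequality holomorphic_on_subset[OF hol] bd
        holomorphic_on_imp_continuous_on[OF holomorphic_on_subset[OF hol sub]]) auto
  then show ?thesis by (simp add: mult.commute)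
qed

lemma holomorphic_second_order:
  assumes hol: "f holomorphic_on ball 0 R" and R: "R > 0"
    and bd: "\<And>z. z \<in> ball 0 R \<Longrightarrow> cmod (f z) \<le> M" and z: "cmod z \<le> R / 2"
  shows "cmod (f z - f 0 - z * deriv f 0) \<le> 32 * M / R\<^sup>2 * (cmod z)\<^sup>2"
proof -
  let ?S = "cball (0 :: complex) (R / 2)"
  have in_ball: "w \<in> ball 0 R" if "w \<in> ?S" for w
    using that R by auto
  have d2: "cmod ((deriv ^^ 2) f w) \<le> 32 * M / R\<^sup>2" if w: "w \<in> ?S" for w
  proof -
    have sub: "cball w (R / 4) \<subseteq> ball 0 R"
    proof
      fix u assume "u \<in> cball w (R / 4)"
      then show "u \<in> ball 0 R"
        using w R norm_triangle_ineq[of w "u - w"] by (simp add: dist_norm norm_minus_commute)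
    qed
    have "cmod ((deriv ^^ 2) f w) \<le> fact 2 * M / (R / 4) ^ 2"
    proof (rule Cauchy_inequality)
      show "f holomorphic_on ball w (R / 4)"
        using sub ball_subset_cball by (intro holomorphic_on_subset[OF hol]) blast
      show "continuous_on (cball w (R / 4)) f"
        using sub by (intro holomorphic_on_imp_continuous_on holomorphic_on_subset[OF hol])
      show "cmod (f x) \<le> M" if "cmod (w - x) = R / 4" for x
        using sub that by (intro bd) (auto simp: dist_norm subset_iff)
    qed (use R in auto)
    then show ?thesis by (simp add: power_divide)
  qed
  have "cmod ((deriv ^^ 0) f z - (\<Sum>i\<le>1. (deriv ^^ i) f 0 * (z - 0) ^ i / fact i))
    \<le> 32 * M / R\<^sup>2 * cmod (z - 0) ^ Suc 1 / fact 1"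
  proof (rule complex_Taylor[where S = ?S])
    fix i x assume "x \<in> ?S"
    then show "((deriv ^^ i) f has_field_derivative (deriv ^^ Suc i) f x) (at x within ?S)"
      using holomorphic_higher_deriv[OF hol, of i] in_ball
      by (auto intro!: holomorphic_derivI[of _ "ball 0 R"])
  qed (use d2 z R in \<open>auto simp: numeral_2_eq_2\<close>)
  then show ?thesis
    by (simp add: power2_eq_square algebra_simps)
qed

text \<open>Dunford's principle: holomorphy tested by a norming family of functionals already gives a
  strong derivative.\<close>

lemma weakly_holomorphic_second_order:
  fixes f :: "complex \<Rightarrow> 'c::complex_banach"
  assumes lin: "\<And>l. l \<in> N \<Longrightarrow> complex_linear l"
    and norming: "\<And>y C. (\<And>l. l \<in> N \<Longrightarrow> cmod (l y) \<le> C) \<Longrightarrow> norm y \<le> C"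
    and l_le: "\<And>l y. l \<in> N \<Longrightarrow> cmod (l y) \<le> norm y"
    and hol: "\<And>l. l \<in> N \<Longrightarrow> (\<lambda>z. l (f z)) holomorphic_on ball 0 R"
    and bd: "\<And>z. z \<in> ball 0 R \<Longrightarrow> norm (f z) \<le> M" and R: "R > 0"
  obtains d where
    "\<And>z. cmod z \<le> R / 2 \<Longrightarrow> norm (f z - f 0 - z *\<^sub>C d) \<le> 32 * M / R\<^sup>2 * (cmod z)\<^sup>2"
proof -
  define K where "K = 32 * M / R\<^sup>2"
  have "M \<ge> 0"
    using bd[of 0] R by (auto intro: order_trans[OF norm_ge_zero])
  then have K: "K \<ge> 0" by (simp add: K_def)
  define q where "q z = (1 / z) *\<^sub>C (f z - f 0)" for z
  have q: "norm (q z - q w) \<le> K * (cmod z + cmod w)"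
    if z: "z \<noteq> 0" "cmod z \<le> R / 2" and w: "w \<noteq> 0" "cmod w \<le> R / 2" for z w
  proof (rule norming)
    fix l assume l: "l \<in> N"
    note lD = complex_linearD[OF lin[OF l]]
    let ?D = "deriv (\<lambda>z. l (f z)) 0"
    have *: "cmod (l (q u) - ?D) \<le> K * cmod u" if u: "u \<noteq> 0" "cmod u \<le> R / 2" for u
    proof -
      have "cmod (l (f u) - l (f 0) - u * ?D) \<le> K * (cmod u)\<^sup>2"
        unfolding K_def using l u order_trans[OF l_le[OF l] bd]
        by (intro holomorphic_second_order[OF hol R]) auto
      moreover have "l (f u) - l (f 0) - u * ?D = u * (l (q u) - ?D)"
        using u by (simp add: q_def lD scaleC_complex_def algebra_simps)
      ultimately show ?thesis
        using u by (simp add: norm_mult power2_eq_square mult.left_commute)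
    qed
    have "cmod (l (q z - q w)) = cmod ((l (q z) - ?D) - (l (q w) - ?D))"
      by (simp add: lD)
    also have "\<dots> \<le> K * cmod z + K * cmod w"
      using *[OF z] *[OF w] norm_triangle_ineq4 add_mono order_trans by blast
    finally show "cmod (l (q z - q w)) \<le> K * (cmod z + cmod w)"
      by (simp add: algebra_simps)
  qed
  define e where "e n = complex_of_real (R / 2 / real (Suc n))" for n
  have norm_e: "cmod (e n) = R / 2 * inverse (real (Suc n))" for n
    unfolding e_def norm_of_real divide_inverse using R by (simp add: abs_mult)
  have e: "e n \<noteq> 0" "cmod (e n) \<le> R / 2" for n
  proof -
    have pos: "0 < inverse (real (Suc n))" and le: "inverse (real (Suc n)) \<le> 1"
      by (simp_all add: inverse_le_1_iff)
    then have "0 < cmod (e n)" "cmod (e n) \<le> R / 2 * 1"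
      unfolding norm_e using R mult_pos_pos[of "R / 2" "inverse (real (Suc n))"]
        mult_left_mono[OF le, of "R / 2"] by linarith+
    then show "e n \<noteq> 0" "cmod (e n) \<le> R / 2"
      by auto
  qed
  have e0: "(\<lambda>n. cmod (e n)) \<longlonglongrightarrow> 0"
  proof -
    have "(\<lambda>n. R / 2 * inverse (real (Suc n))) \<longlonglongrightarrow> R / 2 * 0"
      by (intro tendsto_intros LIMSEQ_inverse_real_of_nat)
    then show ?thesis by (simp add: norm_e)
  qed
  have "Cauchy (\<lambda>n. q (e n))"
  proof (rule CauchyI)
    fix \<epsilon> :: real assume \<epsilon>: "\<epsilon> > 0"
    have "(\<lambda>n. K * cmod (e n)) \<longlonglongrightarrow> K * 0"
      by (intro tendsto_intros e0)
    then have "\<forall>\<^sub>F n in sequentially. K * cmod (e n) < \<epsilon> / 2"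
      using \<epsilon> by (intro order_tendstoD) auto
    then obtain n0 where n0: "\<And>n. n \<ge> n0 \<Longrightarrow> K * cmod (e n) < \<epsilon> / 2"
      unfolding eventually_sequentially by blast
    show "\<exists>M. \<forall>m\<ge>M. \<forall>n\<ge>M. norm (q (e m) - q (e n)) < \<epsilon>"
    proof (intro exI allI impI)
      fix m n assume "m \<ge> n0" "n \<ge> n0"
      then show "norm (q (e m) - q (e n)) < \<epsilon>"
        using q[OF e e, of m n] n0[of m] n0[of n] by (simp add: algebra_simps)
    qed
  qed
  then obtain d where d: "(\<lambda>n. q (e n)) \<longlonglongrightarrow> d"
    using Cauchy_convergent_iff convergent_def by blast
  have "norm (f z - f 0 - z *\<^sub>C d) \<le> K * (cmod z)\<^sup>2" if "cmod z \<le> R / 2" for z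
  proof (cases "z = 0")
    case False
    have "norm (q z - d) \<le> K * (cmod z + 0)"
    proof (rule tendsto_le)
      show "(\<lambda>n. norm (q z - q (e n))) \<longlonglongrightarrow> norm (q z - d)"
        by (intro tendsto_intros d)
      show "(\<lambda>n. K * (cmod z + cmod (e n))) \<longlonglongrightarrow> K * (cmod z + 0)"
        by (intro tendsto_intros e0)
    qed (use q[OF False that e] in auto)
    moreover have "f z - f 0 - z *\<^sub>C d = z *\<^sub>C (q z - d)"
      using False by (simp add: q_def scaleC.diff_right scaleC_scaleC)
    ultimately show ?thesis
      using mult_left_mono[of "norm (q z - d)" "K * cmod z" "cmod z"]
      by (simp add: norm_scaleC power2_eq_square mult.left_commute)
  qed simp
  then show ?thesis using that unfolding K_def by blast
qed

context
  fixes F :: "'a::complex_banach \<Rightarrow> 'b::complex_banach" and a :: 'a and r M :: real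
  assumes F: "complex_differentiable_on F (ball a r)" and r: "r > 0"
    and M: "\<And>x. x \<in> ball a r \<Longrightarrow> norm (F x) \<le> M"
begin

private lemma M_nonneg: "M \<ge> 0"
  using M[of a] r by (auto intro: order_trans[OF norm_ge_zero])

private lemma shift_in_ball:
  assumes "x \<in> ball a (r / 2)" "norm v \<le> r / 2"
  shows "x + v \<in> ball a r"
  using assms norm_triangle_ineq[of "x - a" v] by (simp add: dist_norm norm_minus_commute algebra_simps)

private lemma slice_bounds:
  assumes x: "x \<in> ball a (r / 2)" and v: "v \<noteq> 0"
    and T: "complex_linear (blinfun_apply T)" "norm T \<le> 1"
  defines "f \<equiv> \<lambda>z. blinfun_apply T (F (x + z *\<^sub>C v))"
  defines "R \<equiv> r / (2 * norm v)"
  shows "R > 0" "f holomorphic_on ball 0 R" "deriv f 0 = blinfun_apply T (blinfun_apply (frechet F x) v)"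
    "\<And>z. z \<in> ball 0 R \<Longrightarrow> cmod (f z) \<le> M"
proof -
  have inb: "x + z *\<^sub>C v \<in> ball a r" if "z \<in> ball 0 R" for z
    using that v by (intro shift_in_ball x) (simp add: norm_scaleC R_def field_simps)
  show R: "R > 0" using r v by (simp add: R_def)
  have der: "(f has_field_derivative blinfun_apply T (blinfun_apply (frechet F (x + z *\<^sub>C v)) v)) (at z)"
    if "z \<in> ball 0 R" for z
    unfolding f_def using inb[OF that] by (intro has_field_derivative_functional has_derivative_slice[OF F] T)
  then show "f holomorphic_on ball 0 R"
    by (meson at_within_open holomorphic_on_open open_ball)
  show "deriv f 0 = blinfun_apply T (blinfun_apply (frechet F x) v)"
    using der[of 0] R by (simp add: DERIV_imp_deriv)
  show "cmod (f z) \<le> M" if "z \<in> ball 0 R" for z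
  proof -
    have "cmod (f z) \<le> norm T * norm (F (x + z *\<^sub>C v))"
      unfolding f_def by (rule norm_blinfun)
    also have "\<dots> \<le> 1 * M"
      using inb[OF that] T M by (intro mult_mono) auto
    finally show ?thesis by simp
  qed
qed

lemma norm_frechet_le:
  assumes x: "x \<in> ball a (r / 2)"
  shows "norm (frechet F x) \<le> 4 * M / r"
proof (rule norm_blinfun_bound)
  show "norm (blinfun_apply (frechet F x) v) \<le> 4 * M / r * norm v" for v
  proof (cases "v = 0")
    case False
    show ?thesis
    proof (rule norm_le_functional)
      fix T :: "'b \<Rightarrow>\<^sub>L complex" assume T: "complex_linear (blinfun_apply T)" "norm T \<le> 1"
      note sb = slice_bounds[OF x False T]
      show "cmod (blinfun_apply T (blinfun_apply (frechet F x) v)) \<le> 4 * M / r * norm v"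
        using norm_deriv_le[OF sb(2,1,4)] unfolding sb(3) by (simp add: mult_ac)
    qed
  qed simp
qed (use M_nonneg r in auto)

lemma frechet_second_order:
  assumes x: "x \<in> ball a (r / 2)" and v: "norm v \<le> r / 4"
  shows "norm (F (x + v) - F x - blinfun_apply (frechet F x) v) \<le> 128 * M / r\<^sup>2 * (norm v)\<^sup>2"
proof (cases "v = 0")
  case False
  show ?thesis
  proof (rule norm_le_functional)
    fix T :: "'b \<Rightarrow>\<^sub>L complex" assume T: "complex_linear (blinfun_apply T)" "norm T \<le> 1"
    note sb = slice_bounds[OF x False T]
    have "cmod 1 \<le> r / (2 * norm v) / 2"
      using v False by (simp add: field_simps)
    from holomorphic_second_order[OF sb(2,1,4) this, simplified sb(3)]
    show "cmod (blinfun_apply T (F (x + v) - F x - blinfun_apply (frechet F x) v))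
        \<le> 128 * M / r\<^sup>2 * (norm v)\<^sup>2"
      by (simp add: blinfun.diff_right power_divide power_mult_distrib)
  qed
qed simp

lemma frechet_slice_derivative:
  assumes T: "complex_linear (blinfun_apply T)" and R: "R * norm h \<le> r / 2"
  shows "\<exists>g. \<forall>z\<in>ball 0 R.
    ((\<lambda>z. blinfun_apply T (blinfun_apply (frechet F (a + z *\<^sub>C h)) v)) has_field_derivative g z) (at z) \<and>
    (\<forall>\<delta>. 0 < \<delta> \<longrightarrow> \<delta> * norm v \<le> r / 4 \<longrightarrow>
      (\<lambda>n. (blinfun_apply T (blinfun_apply (frechet F (a + z *\<^sub>C h + (of_real (\<delta> / real (Suc n))) *\<^sub>C v)) h)
         - blinfun_apply T (blinfun_apply (frechet F (a + z *\<^sub>C h)) h)) / of_real (\<delta> / real (Suc n)))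
      \<longlonglongrightarrow> g z)"
proof -
  have inb: "a + z *\<^sub>C h \<in> ball a (r / 2)" if "z \<in> ball 0 R" for z
  proof (cases "h = 0")
    case False
    then have "norm (z *\<^sub>C h) < R * norm h"
      using that by (simp add: norm_scaleC)
    then show ?thesis using R by (simp add: dist_norm)
  qed (use r in simp)
  have ex: "\<exists>g. \<forall>z\<in>ball 0 R.
    ((\<lambda>z. blinfun_apply T (blinfun_apply (frechet F (a + z *\<^sub>C h)) v)) has_field_derivative g z) (at z) \<and>
      (\<lambda>n. (blinfun_apply T (blinfun_apply (frechet F (a + z *\<^sub>C h + (of_real (\<delta> / real (Suc n))) *\<^sub>C v)) h)
         - blinfun_apply T (blinfun_apply (frechet F (a + z *\<^sub>C h)) h)) / of_real (\<delta> / real (Suc n)))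
      \<longlonglongrightarrow> g z" (is "\<exists>g. \<forall>z\<in>ball 0 R. (?\<psi> has_field_derivative g z) (at z) \<and> (\<lambda>n. ?d n z) \<longlonglongrightarrow> g z")
    if \<delta>: "0 < \<delta>" "\<delta> * norm v \<le> r / 4" for \<delta> :: real
  proof -
    define e where "e n = \<delta> / real (Suc n)" for n
    have e: "e n > 0" "norm (of_real (e n) *\<^sub>C v) \<le> r / 4" for n
    proof -
      show "e n > 0" using \<delta> by (simp add: e_def)
      have "e n \<le> \<delta>" using \<delta> by (simp add: e_def divide_le_eq mult_le_cancel_left1)
      then have "e n * norm v \<le> \<delta> * norm v" by (rule mult_right_mono) simp
      then show "norm (of_real (e n) *\<^sub>C v) \<le> r / 4"
        using \<delta>(2) \<open>e n > 0\<close> by (simp add: norm_scaleC)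
    qed
    define \<phi> where "\<phi> n z = (blinfun_apply T (F (a + z *\<^sub>C h + of_real (e n) *\<^sub>C v))
      - blinfun_apply T (F (a + z *\<^sub>C h))) / of_real (e n)" for n z
    have der: "(\<phi> n has_field_derivative ?d n z) (at z)" if z: "z \<in> ball 0 R" for n z
    proof -
      have sw: "a + w *\<^sub>C h + of_real (e n) *\<^sub>C v = (a + of_real (e n) *\<^sub>C v) + w *\<^sub>C h" for w
        by simp
      have 1: "((\<lambda>z. blinfun_apply T (F (a + z *\<^sub>C h + of_real (e n) *\<^sub>C v))) has_field_derivative
         blinfun_apply T (blinfun_apply (frechet F (a + z *\<^sub>C h + of_real (e n) *\<^sub>C v)) h)) (at z)"
        unfolding sw
        by (intro has_field_derivative_functional has_derivative_slice[OF F] T)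
          (use shift_in_ball[OF inb[OF z], of "of_real (e n) *\<^sub>C v"] e(2)[of n] r in \<open>simp add: add_ac\<close>)
      have 2: "((\<lambda>z. blinfun_apply T (F (a + z *\<^sub>C h))) has_field_derivative
         blinfun_apply T (blinfun_apply (frechet F (a + z *\<^sub>C h)) h)) (at z)"
        by (intro has_field_derivative_functional has_derivative_slice[OF F] T)
          (use inb[OF z] r in auto)
      show ?thesis
        unfolding \<phi>_def e_def[symmetric] by (intro DERIV_cdivide DERIV_diff 1 2)
    qed
    have close: "dist (\<phi> n z) (?\<psi> z) \<le> norm T * (128 * M / r\<^sup>2 * (norm v)\<^sup>2) * e n"
      if z: "z \<in> ball 0 R" for n z
    proof -
      let ?x = "a + z *\<^sub>C h" and ?v = "of_real (e n) *\<^sub>C v"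
      have D: "blinfun_apply (frechet F ?x) ?v = of_real (e n) *\<^sub>C blinfun_apply (frechet F ?x) v"
        using inb[OF z] r by (intro complex_linearD(2) complex_differentiable_onD(2)[OF F]) auto
      have "of_real (e n) * (\<phi> n z - ?\<psi> z) = blinfun_apply T (F (?x + ?v) - F ?x - blinfun_apply (frechet F ?x) ?v)"
        using e(1)[of n] unfolding \<phi>_def D blinfun.diff_right complex_linearD(2)[OF T]
        by (simp add: scaleC_complex_def right_diff_distrib diff_divide_distrib)
      also have "cmod \<dots> \<le> norm T * (128 * M / r\<^sup>2 * (norm ?v)\<^sup>2)"
        by (intro order_trans[OF norm_blinfun] mult_left_mono frechet_second_order inb z e) auto
      finally have "e n * cmod (\<phi> n z - ?\<psi> z) \<le> e n * (norm T * (128 * M / r\<^sup>2 * (norm v)\<^sup>2) * e n)"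
        using e(1)[of n] by (simp add: norm_mult norm_scaleC power2_eq_square mult_ac)
      then show ?thesis
        unfolding dist_norm using e(1)[of n] by (subst (asm) mult_le_cancel_left_pos)
    qed
    have "e \<longlonglongrightarrow> 0"
    proof -
      have "(\<lambda>n. \<delta> * inverse (real (Suc n))) \<longlonglongrightarrow> \<delta> * 0"
        by (intro tendsto_intros LIMSEQ_inverse_real_of_nat)
      then show ?thesis by (simp add: e_def[abs_def] divide_inverse)
    qed
    then have lim: "(\<lambda>n. norm T * (128 * M / r\<^sup>2 * (norm v)\<^sup>2) * e n) \<longlonglongrightarrow> norm T * (128 * M / r\<^sup>2 * (norm v)\<^sup>2) * 0"
      by (intro tendsto_intros)
    have ul: "uniform_limit (ball 0 R) \<phi> ?\<psi> sequentially"
    proof (rule uniform_limitI)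
      fix \<epsilon> :: real assume "\<epsilon> > 0"
      then have "\<forall>\<^sub>F n in sequentially. norm T * (128 * M / r\<^sup>2 * (norm v)\<^sup>2) * e n < \<epsilon>"
        using lim by (intro order_tendstoD) auto
      then show "\<forall>\<^sub>F n in sequentially. \<forall>z\<in>ball 0 R. dist (\<phi> n z) (?\<psi> z) < \<epsilon>"
        by eventually_elim (blast intro: le_less_trans[OF close])
    qed
    show ?thesis
    proof (rule has_complex_derivative_uniform_sequence[OF open_ball der])
      fix x :: complex assume "x \<in> ball 0 R"
      then obtain d where "d > 0" "cball x d \<subseteq> ball 0 R"
        using open_contains_cball open_ball by metis
      then show "\<exists>d>0. cball x d \<subseteq> ball 0 R \<and> uniform_limit (cball x d) \<phi> ?\<psi> sequentially"
        using uniform_limit_on_subset[OF ul] by blast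
    qed
  qed
  define \<delta>0 where "\<delta>0 = r / (4 * (norm v + 1))"
  have n: "norm v + 1 > 0" using norm_ge_zero[of v] by linarith
  have "0 < \<delta>0" "\<delta>0 * norm v \<le> r / 4"
    using r n by (auto simp: \<delta>0_def field_simps)
  from ex[OF this] obtain g where g: "\<And>z. z \<in> ball 0 R \<Longrightarrow>
    ((\<lambda>z. blinfun_apply T (blinfun_apply (frechet F (a + z *\<^sub>C h)) v)) has_field_derivative g z) (at z)"
    by blast
  show ?thesis
  proof (intro exI ballI conjI allI impI)
    fix z \<delta> assume z: "z \<in> ball (0 :: complex) R" and "0 < \<delta>" "\<delta> * norm v \<le> r / 4"
    from ex[OF this(2,3)] z obtain g' where
      "((\<lambda>z. blinfun_apply T (blinfun_apply (frechet F (a + z *\<^sub>C h)) v)) has_field_derivative g') (at z)"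
      and lim: "(\<lambda>n. (blinfun_apply T (blinfun_apply (frechet F (a + z *\<^sub>C h + (of_real (\<delta> / real (Suc n))) *\<^sub>C v)) h)
         - blinfun_apply T (blinfun_apply (frechet F (a + z *\<^sub>C h)) h)) / of_real (\<delta> / real (Suc n)))
      \<longlonglongrightarrow> g'"
      by blast
    then have "g' = g z" using DERIV_unique g[OF z] by blast
    with lim show "(\<lambda>n. (blinfun_apply T (blinfun_apply (frechet F (a + z *\<^sub>C h + (of_real (\<delta> / real (Suc n))) *\<^sub>C v)) h)
         - blinfun_apply T (blinfun_apply (frechet F (a + z *\<^sub>C h)) h)) / of_real (\<delta> / real (Suc n)))
      \<longlonglongrightarrow> g z" by simp
  qed (rule g)
qed

lemma frechet_has_derivative:
  shows "\<exists>B. (frechet F has_derivative B) (at a) \<and> complex_linear B"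
proof -
  define K1 where "K1 = 4 * M / r"
  define K where "K = 128 * K1 / r\<^sup>2"
  define N where "N = {\<lambda>A :: 'a \<Rightarrow>\<^sub>L 'b. blinfun_apply T (blinfun_apply A v) | (T :: 'b \<Rightarrow>\<^sub>L complex) v.
    complex_linear (blinfun_apply T) \<and> norm T \<le> 1 \<and> norm v \<le> 1}"
  have K1: "K1 \<ge> 0" using M_nonneg r by (simp add: K1_def)
  have "\<exists>d. \<forall>z. cmod z * norm h \<le> r / 4 \<longrightarrow>
    norm (frechet F (a + z *\<^sub>C h) - frechet F a - z *\<^sub>C d) \<le> K * (cmod z)\<^sup>2 * (norm h)\<^sup>2" for h
  proof (cases "h = 0")
    case True
    then show ?thesis by (intro exI[of _ 0]) simp
  next
    case h: False
    define R where "R = r / (2 * norm h)"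
    have R: "R > 0" "R * norm h \<le> r / 2"
      using h r by (auto simp: R_def)
    obtain d where d: "\<And>z. cmod z \<le> R / 2 \<Longrightarrow>
        norm (frechet F (a + z *\<^sub>C h) - frechet F (a + 0 *\<^sub>C h) - z *\<^sub>C d) \<le> 32 * K1 / R\<^sup>2 * (cmod z)\<^sup>2"
    proof (rule weakly_holomorphic_second_order[where N = N and M = K1 and R = R
          and f = "\<lambda>z. frechet F (a + z *\<^sub>C h)"])
      fix l assume "l \<in> N"
      then obtain T :: "'b \<Rightarrow>\<^sub>L complex" and v where l: "l = (\<lambda>A. blinfun_apply T (blinfun_apply A v))"
        and T: "complex_linear (blinfun_apply T)" "norm T \<le> 1" and v: "norm v \<le> 1"
        by (auto simp: N_def)
      show "complex_linear l"
        using T(1) by (simp add: l complex_linear_def blinfun.add_left)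
      show "cmod (l y) \<le> norm y" for y
      proof -
        have "cmod (l y) \<le> norm T * norm (blinfun_apply y v)"
          unfolding l by (rule norm_blinfun)
        also have "\<dots> \<le> 1 * (norm y * 1)"
          by (intro mult_mono T order_trans[OF norm_blinfun] v) auto
        finally show ?thesis by simp
      qed
      show "(\<lambda>z. l (frechet F (a + z *\<^sub>C h))) holomorphic_on ball 0 R"
        using frechet_slice_derivative[OF T(1) R(2), of v] unfolding l
        by (meson at_within_open holomorphic_on_open open_ball)
    next
      fix y :: "'a \<Rightarrow>\<^sub>L 'b" and C
      assume *: "\<And>l. l \<in> N \<Longrightarrow> cmod (l y) \<le> C"
      have **: "norm (blinfun_apply y v) \<le> C" if "norm v \<le> 1" for v
      proof (rule norm_le_functional)
        fix T :: "'b \<Rightarrow>\<^sub>L complex" assume "complex_linear (blinfun_apply T)" "norm T \<le> 1"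
        then show "cmod (blinfun_apply T (blinfun_apply y v)) \<le> C"
          using that by (intro *[of "\<lambda>A. blinfun_apply T (blinfun_apply A v)"]) (auto simp: N_def)
      qed
      show "norm y \<le> C"
      proof (rule norm_blinfun_bound)
        show "0 \<le> C" using **[of 0] by simp
        show "norm (blinfun_apply y v) \<le> C * norm v" for v
        proof (cases "v = 0")
          case False
          have "norm (blinfun_apply y (v /\<^sub>R norm v)) \<le> C"
            using False by (intro **) simp
          then show ?thesis
            using False by (simp add: blinfun.scaleR_right field_simps)
        qed simp
      qed
    next
      fix z :: complex assume "z \<in> ball 0 R"
      then have "a + z *\<^sub>C h \<in> ball a (r / 2)"
        using h by (simp add: dist_norm norm_scaleC R_def field_simps)
      then show "norm (frechet F (a + z *\<^sub>C h)) \<le> K1"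
        unfolding K1_def by (rule norm_frechet_le)
    qed (use R that in auto)
    show ?thesis
    proof (intro exI allI impI)
      fix z assume "cmod z * norm h \<le> r / 4"
      then have "cmod z \<le> R / 2" using h by (simp add: R_def field_simps)
      from d[OF this] show "norm (frechet F (a + z *\<^sub>C h) - frechet F a - z *\<^sub>C d)
          \<le> K * (cmod z)\<^sup>2 * (norm h)\<^sup>2"
        by (simp add: K_def R_def power_divide power_mult_distrib mult_ac)
    qed
  qed
  then obtain B where B: "\<And>h z. cmod z * norm h \<le> r / 4 \<Longrightarrow>
    norm (frechet F (a + z *\<^sub>C h) - frechet F a - z *\<^sub>C B h) \<le> K * (cmod z)\<^sup>2 * (norm h)\<^sup>2"
    by metis
  have derB: "((\<lambda>z. blinfun_apply T (blinfun_apply (frechet F (a + z *\<^sub>C h)) v))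
      has_field_derivative blinfun_apply T (blinfun_apply (B h) v)) (at 0)"
    if T: "complex_linear (blinfun_apply T)" for T h v
  proof -
    define \<delta> where "\<delta> = r / (4 * (norm h + 1))"
    have n: "norm h + 1 > 0" using norm_ge_zero[of h] by linarith
    have \<delta>: "\<delta> > 0" "\<delta> * norm h \<le> r / 4"
      using r n by (auto simp: \<delta>_def field_simps)
    have "((\<lambda>z. frechet F (a + z *\<^sub>C h)) has_derivative (\<lambda>z. z *\<^sub>C B h)) (at 0)"
    proof (rule has_derivative_quadratic[OF scaleC.bounded_linear_left \<delta>(1)])
      fix z assume "cmod z < \<delta>"
      then have "cmod z * norm h \<le> r / 4"
        using \<delta>(2) mult_right_mono[of "cmod z" \<delta> "norm h"] by simp
      from B[OF this] show "norm (frechet F (a + (0 + z) *\<^sub>C h) - frechet F (a + 0 *\<^sub>C h) - z *\<^sub>C B h)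
          \<le> (K * (norm h)\<^sup>2) * (cmod z)\<^sup>2"
        by (simp add: mult_ac)
    qed
    from bounded_linear.has_derivative[OF blinfun.bounded_linear_left this, of v]
    have "((\<lambda>z. blinfun_apply (frechet F (a + z *\<^sub>C h)) v) has_derivative
        (\<lambda>z. z *\<^sub>C blinfun_apply (B h) v)) (at 0)"
      by simp
    then show ?thesis by (rule has_field_derivative_functional[OF _ T])
  qed
  have sep: "y = z" if "\<And>T :: 'b \<Rightarrow>\<^sub>L complex. complex_linear (blinfun_apply T) \<Longrightarrow> blinfun_apply T y = blinfun_apply T z"
    for y z :: 'b
  proof -
    have "norm (y - z) \<le> 0"
      by (rule norm_le_functional) (simp add: blinfun.diff_right that)
    then show ?thesis by simp
  qed
  have sym: "blinfun_apply (B h) v = blinfun_apply (B v) h" for h v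
  proof (rule sep)
    fix T :: "'b \<Rightarrow>\<^sub>L complex" assume T: "complex_linear (blinfun_apply T)"
    define R where "R = r / (2 * (norm h + 1))"
    have n: "norm h + 1 > 0" "norm v + 1 > 0"
      using norm_ge_zero[of h] norm_ge_zero[of v] by linarith+
    have R: "R > 0" "R * norm h \<le> r / 2"
      using r n by (auto simp: R_def field_simps)
    define \<delta> where "\<delta> = r / (4 * (norm v + 1))"
    have \<delta>: "\<delta> > 0" "\<delta> * norm v \<le> r / 4"
      using r n by (auto simp: \<delta>_def field_simps)
    define e where "e n = complex_of_real (\<delta> / real (Suc n))" for n
    let ?\<chi> = "\<lambda>z. blinfun_apply T (blinfun_apply (frechet F (a + z *\<^sub>C v)) h)"
    from frechet_slice_derivative[OF T R(2), of v] \<delta> R(1) obtain g where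
      g: "((\<lambda>z. blinfun_apply T (blinfun_apply (frechet F (a + z *\<^sub>C h)) v)) has_field_derivative g 0) (at 0)"
         "(\<lambda>n. (?\<chi> (e n) - ?\<chi> 0) / (e n - 0)) \<longlonglongrightarrow> g 0"
      unfolding e_def by (auto dest!: bspec[of _ _ 0])
    have "filterlim e (at 0) sequentially"
    proof (rule filterlim_atI)
      have "(\<lambda>n. of_real (\<delta> * inverse (real (Suc n)))) \<longlonglongrightarrow> complex_of_real (\<delta> * 0)"
        by (intro tendsto_intros LIMSEQ_inverse_real_of_nat)
      then show "e \<longlonglongrightarrow> 0" by (simp add: e_def[abs_def] divide_inverse)
      show "\<forall>\<^sub>F n in sequentially. e n \<noteq> 0"
        using \<delta> by (simp add: e_def del: of_nat_Suc)
    qed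
    moreover have "((\<lambda>z. (?\<chi> z - ?\<chi> 0) / (z - 0)) \<longlongrightarrow> blinfun_apply T (blinfun_apply (B v) h)) (at 0)"
      using derB[OF T, of v h] by (simp add: has_field_derivative_iff)
    ultimately have "(\<lambda>n. (?\<chi> (e n) - ?\<chi> 0) / (e n - 0)) \<longlonglongrightarrow> blinfun_apply T (blinfun_apply (B v) h)"
      by (rule filterlim_compose[rotated])
    then have "g 0 = blinfun_apply T (blinfun_apply (B v) h)"
      using g(2) LIMSEQ_unique by blast
    then show "blinfun_apply T (blinfun_apply (B h) v) = blinfun_apply T (blinfun_apply (B v) h)"
      using DERIV_unique[OF derB[OF T, of h v] g(1)] by simp
  qed
  have add: "B (x + y) = B x + B y" for x y
    by (rule blinfun_eqI) (simp add: sym[of _ "_ :: 'a"] blinfun.add_left, metis sym blinfun.add_right)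
  have sc: "B (c *\<^sub>C x) = c *\<^sub>C B x" for c x
  proof (rule blinfun_eqI)
    fix v
    show "blinfun_apply (B (c *\<^sub>C x)) v = blinfun_apply (c *\<^sub>C B x) v"
    proof (rule sep)
      fix T :: "'b \<Rightarrow>\<^sub>L complex" assume T: "complex_linear (blinfun_apply T)"
      let ?f = "\<lambda>z. blinfun_apply T (blinfun_apply (frechet F (a + z *\<^sub>C x)) v)"
      have "((\<lambda>z. ?f (z * c)) has_field_derivative blinfun_apply T (blinfun_apply (B x) v) * c) (at 0)"
        by (rule DERIV_chain2[of ?f]) (use derB[OF T, of x v] in \<open>auto intro!: derivative_eq_intros\<close>)
      moreover have "((\<lambda>z. ?f (z * c)) has_field_derivative
          blinfun_apply T (blinfun_apply (B (c *\<^sub>C x)) v)) (at 0)"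
        using derB[OF T, of "c *\<^sub>C x" v] by (simp add: scaleC_scaleC)
      ultimately show "blinfun_apply T (blinfun_apply (B (c *\<^sub>C x)) v) = blinfun_apply T (blinfun_apply (c *\<^sub>C B x) v)"
        using DERIV_unique by (fastforce simp: complex_linearD(2)[OF T] scaleC_complex_def mult.commute)
    qed
  qed
  have cl: "complex_linear B"
    by (simp add: complex_linear_def add sc)
  have "norm (B h) \<le> norm h * ((2 * K1 + K * (r / 8)\<^sup>2) * 8 / r)" for h
  proof (cases "h = 0")
    case True
    then show ?thesis using complex_linearD(3)[OF cl] by simp
  next
    case False
    define t where "t = r / (8 * norm h)"
    have t: "t > 0" "t * norm h = r / 8"
      using False r by (auto simp: t_def)
    have "t * norm (B h) = norm (of_real t *\<^sub>C B h)"
      using t by (simp add: norm_scaleC)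
    also have "of_real t *\<^sub>C B h = frechet F (a + of_real t *\<^sub>C h) - frechet F a -
       (frechet F (a + of_real t *\<^sub>C h) - frechet F a - of_real t *\<^sub>C B h)"
      by simp
    also have "norm \<dots> \<le> (K1 + K1) + K * (cmod (of_real t))\<^sup>2 * (norm h)\<^sup>2"
    proof (rule order_trans[OF norm_triangle_ineq4 add_mono])
      have "a + of_real t *\<^sub>C h \<in> ball a (r / 2)" "a \<in> ball a (r / 2)"
        using t r by (simp_all add: dist_norm norm_scaleC)
      then show "norm (frechet F (a + of_real t *\<^sub>C h) - frechet F a) \<le> K1 + K1"
        unfolding K1_def by (intro order_trans[OF norm_triangle_ineq4] add_mono norm_frechet_le)
      show "norm (frechet F (a + of_real t *\<^sub>C h) - frechet F a - of_real t *\<^sub>C B h)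
          \<le> K * (cmod (of_real t))\<^sup>2 * (norm h)\<^sup>2"
        using t r by (intro B) simp
    qed
    also have "\<dots> = 2 * K1 + K * (r / 8)\<^sup>2"
      unfolding t(2)[symmetric] using t(1) by (simp add: power_mult_distrib)
    finally show ?thesis
      using False r by (simp add: t_def field_simps)
  qed
  then have bl: "bounded_linear B"
    by (intro bounded_linear_intro[of _ "(2 * K1 + K * (r / 8)\<^sup>2) * 8 / r"])
      (auto simp: add complex_linearD(6)[OF cl])
  have "(frechet F has_derivative B) (at a)"
  proof (rule has_derivative_quadratic[OF bl])
    show "r / 4 > 0" using r by simp
    show "norm (frechet F (a + h) - frechet F a - B h) \<le> K * (norm h)\<^sup>2" if "norm h < r / 4" for h
      using B[of 1 h] that by simp
  qed
  then show ?thesis using cl by blast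
qed

end

theorem complex_differentiable_on_frechet:
  assumes F: "complex_differentiable_on F S" and S: "open S"
  shows "complex_differentiable_on (frechet F) S"
  unfolding complex_differentiable_on_def
proof
  fix a assume a: "a \<in> S"
  have "continuous (at a) F"
    using complex_differentiable_onD(1)[OF F a] has_derivative_continuous by blast
  then obtain d where d: "d > 0" "\<And>x. dist x a < d \<Longrightarrow> dist (F x) (F a) < 1"
    unfolding continuous_at_eps_delta by (metis zero_less_one)
  obtain e where e: "e > 0" "ball a e \<subseteq> S"
    using S a open_contains_ball by blast
  show "\<exists>B. (frechet F has_derivative B) (at a) \<and> complex_linear B"
  proof (rule frechet_has_derivative)
    show "complex_differentiable_on F (ball a (min d e))"
      using e by (intro complex_differentiable_on_subset[OF F]) auto
    show "norm (F x) \<le> norm (F a) + 1" if "x \<in> ball a (min d e)" for x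
      using d(2)[of x] that norm_triangle_ineq2[of "F x" "F a"] by (simp add: dist_norm norm_minus_commute)
  qed (use d e in auto)
qed

section \<open>Coefficients of bounded holomorphic functions\<close>

lemma fps_expansion_eq_on_ball:
  assumes "f has_fps_expansion F" "g has_fps_expansion G" "r > 0"
    and "\<And>z. z \<in> ball 0 r \<Longrightarrow> f z = g (z :: complex)"
  shows "F = G"
proof -
  have "eventually (\<lambda>z. f z = g z) (nhds 0)"
    using assms eventually_nhds_in_open[of "ball (0 :: complex) r" 0]
    by (auto elim!: eventually_mono)
  then have "f has_fps_expansion G"
    using assms(2) has_fps_expansion_cong by blast
  then show ?thesis
    using assms(1) fps_expansion_unique_complex by blast
qed

lemma holomorphic_has_fps_expansion:
  assumes "f holomorphic_on ball 0 r" "r > 0"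
  shows "f has_fps_expansion fps_expansion f (0 :: complex)"
  using assms by (intro analytic_at_imp_has_fps_expansion_0) (metis analytic_at centre_in_ball open_ball)

lemma fps_nth_eq_0_of_bound:
  assumes f: "f has_fps_expansion E" and \<delta>: "\<delta> > 0"
    and bd: "\<And>z :: complex. cmod z < \<delta> \<Longrightarrow> cmod (f z) \<le> C * cmod z ^ n" and k: "k < n"
  shows "fps_nth E k = 0"
proof -
  obtain A where A: "open A" "0 \<in> A" "f holomorphic_on A"
    using has_fps_expansion_imp_holomorphic[OF f] by metis
  obtain e where e: "e > 0" "ball 0 e \<subseteq> A"
    using A open_contains_ball by blast
  have C: "C \<ge> 0"
  proof -
    have "0 \<le> C * cmod (of_real (\<delta> / 2)) ^ n"
      using \<delta> by (intro order_trans[OF norm_ge_zero bd]) auto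
    moreover have "0 < cmod (of_real (\<delta> / 2)) ^ n" using \<delta> by simp
    ultimately show ?thesis using zero_le_mult_iff not_le by metis
  qed
  have le: "cmod ((deriv ^^ k) f 0) \<le> fact k * C * r" if r: "0 < r" "r < min 1 (min \<delta> e)" for r
  proof -
    have sub: "cball 0 r \<subseteq> A" using r e by auto
    have "cmod ((deriv ^^ k) f 0) \<le> fact k * (C * r ^ n) / r ^ k"
    proof (rule Cauchy_inequality)
      show "f holomorphic_on ball 0 r"
        using sub ball_subset_cball by (blast intro: holomorphic_on_subset[OF A(3)])
      show "continuous_on (cball 0 r) f"
        using sub by (intro holomorphic_on_imp_continuous_on holomorphic_on_subset[OF A(3)])
      show "cmod (f x) \<le> C * r ^ n" if "cmod (0 - x) = r" for x
        using bd[of x] that r by simp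
    qed (use r in auto)
    also have "\<dots> = fact k * C * r ^ (n - k)"
      using r k by (simp add: power_diff)
    also have "\<dots> \<le> fact k * C * r ^ 1"
      using r k C by (intro mult_left_mono power_decreasing) auto
    finally show ?thesis by simp
  qed
  have "cmod ((deriv ^^ k) f 0) \<le> 0"
  proof (rule tendsto_le)
    show "((\<lambda>r. fact k * C * r) \<longlongrightarrow> 0) (at_right 0)"
      by (auto intro!: tendsto_eq_intros)
    show "((\<lambda>r :: real. cmod ((deriv ^^ k) f 0)) \<longlongrightarrow> cmod ((deriv ^^ k) f 0)) (at_right 0)"
      by simp
    have "0 < min 1 (min \<delta> e)" using \<delta> e by simp
    from eventually_at_right_real[OF this]
    show "\<forall>\<^sub>F r in at_right 0. cmod ((deriv ^^ k) f 0) \<le> fact k * C * r"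
      by eventually_elim (use le in auto)
  qed simp
  then show ?thesis
    by (simp add: fps_nth_fps_expansion[OF f])
qed

lemma bounded_holomorphic_cases:
  assumes hol: "g holomorphic_on ball 0 1"
    and bd: "\<And>z :: complex. z \<in> ball 0 1 \<Longrightarrow> cmod (g z) \<le> 1"
  obtains "\<And>z. z \<in> ball 0 1 \<Longrightarrow> cmod (g z) < 1"
  | c where "cmod c = 1" "\<And>z. z \<in> ball 0 1 \<Longrightarrow> g z = c"
proof (cases "\<exists>w\<in>ball 0 1. cmod (g w) = 1")
  case False
  then show ?thesis using that(1) bd by (metis less_eq_real_def)
next
  case True
  then obtain w where w: "w \<in> ball 0 1" "cmod (g w) = 1" by blast
  have "g constant_on ball 0 1"
    by (rule maximum_modulus_principle[where U = "ball 0 1" and \<xi> = w, OF hol]) (use bd w in auto)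
  then obtain c where "\<And>z. z \<in> ball 0 1 \<Longrightarrow> g z = c"
    by (auto simp: constant_on_def)
  then show ?thesis using that(2) w by metis
qed

lemma norm_mobius_less_1:
  assumes "cmod a < 1" "cmod b < 1"
  shows "cmod ((b - a) / (1 - cnj a * b)) < 1"
proof -
  have *: "(cmod (1 - cnj a * b))\<^sup>2 - (cmod (b - a))\<^sup>2 = (1 - (cmod a)\<^sup>2) * (1 - (cmod b)\<^sup>2)"
    unfolding cmod_power2 by (simp add: algebra_simps power2_eq_square)
  have "0 < (1 - (cmod a)\<^sup>2) * (1 - (cmod b)\<^sup>2)"
    using assms by (intro mult_pos_pos) (simp_all add: power_less_one_iff abs_square_less_1)
  then have "(cmod (b - a))\<^sup>2 < (cmod (1 - cnj a * b))\<^sup>2"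
    using * by simp
  then have "cmod (b - a) < cmod (1 - cnj a * b)"
    by (rule power_less_imp_less_base) simp
  then show ?thesis
    by (simp add: norm_divide divide_less_eq)
qed

lemma schur_step:
  assumes hol: "g holomorphic_on ball 0 1"
    and bd: "\<And>z :: complex. z \<in> ball 0 1 \<Longrightarrow> cmod (g z) \<le> 1" and g0: "cmod (g 0) < 1"
  obtains k where "k holomorphic_on ball 0 1" "\<And>z. z \<in> ball 0 1 \<Longrightarrow> cmod (k z) \<le> 1"
    "\<And>z. z \<in> ball 0 1 \<Longrightarrow> g z = g 0 + z * k z * (1 - cnj (g 0) * g z)"
proof -
  have lt: "cmod (g z) < 1" if "z \<in> ball 0 1" for z
  proof (rule bounded_holomorphic_cases[OF hol bd])
    fix c assume "cmod c = 1" "\<And>z. z \<in> ball 0 1 \<Longrightarrow> g z = c"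
    then show ?thesis using g0 by (metis centre_in_ball less_irrefl zero_less_one)
  qed (use that in auto)
  have ne: "1 - cnj (g 0) * g z \<noteq> 0" if "z \<in> ball 0 1" for z
  proof
    assume "1 - cnj (g 0) * g z = 0"
    then have "cmod (g 0) * cmod (g z) = 1"
      by (metis complex_mod_cnj norm_mult norm_one right_minus_eq)
    moreover have "cmod (g 0) * cmod (g z) < 1 * 1"
      using g0 lt[OF that] by (intro mult_strict_mono') auto
    ultimately show False by simp
  qed
  define m where "m z = (g z - g 0) / (1 - cnj (g 0) * g z)" for z
  have m0: "m 0 = 0" by (simp add: m_def)
  have holm: "m holomorphic_on ball 0 1"
    unfolding m_def[abs_def] using ne by (intro holomorphic_intros hol) auto
  have ltm: "cmod (m z) < 1" if "norm z < 1" for z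
    unfolding m_def using that by (intro norm_mobius_less_1 g0 lt) auto
  obtain k where k: "k holomorphic_on ball 0 1" "\<And>z. norm z < 1 \<Longrightarrow> m z = z * k z" "deriv m 0 = k 0"
    using Schwarz3[OF holm m0] by blast
  note SL = Schwarz_Lemma[OF holm m0 ltm]
  show ?thesis
  proof (rule that[OF k(1)])
    fix z :: complex assume z: "z \<in> ball 0 1"
    show "cmod (k z) \<le> 1"
    proof (cases "z = 0")
      case True
      then show ?thesis using SL(2)[of 0] k(3) by simp
    next
      case False
      then show ?thesis
        using SL(1)[of z] k(2)[of z] z by (simp add: norm_mult)
    qed
    show "g z = g 0 + z * k z * (1 - cnj (g 0) * g z)"
      using k(2)[of z] z ne[OF z] by (simp add: m_def field_simps)
  qed
qed

lemma schur_step_coefficients: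
  assumes hol: "g holomorphic_on ball 0 1"
    and bd: "\<And>z :: complex. z \<in> ball 0 1 \<Longrightarrow> cmod (g z) \<le> 1"
  defines "G \<equiv> fps_nth (fps_expansion g 0)"
  obtains k where "k holomorphic_on ball 0 1" "\<And>z. z \<in> ball 0 1 \<Longrightarrow> cmod (k z) \<le> 1"
    "G 1 = k 0 * (1 - of_real ((cmod (G 0))\<^sup>2))"
    "G 2 = fps_nth (fps_expansion k 0) 1 * (1 - of_real ((cmod (G 0))\<^sup>2)) - k 0 * cnj (G 0) * G 1"
proof -
  have exp: "g has_fps_expansion fps_expansion g 0"
    by (rule holomorphic_has_fps_expansion[OF hol]) simp
  have G0: "G 0 = g 0"
    unfolding G_def using has_fps_expansion_imp_0_eq_fps_nth_0[OF exp] by simp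
  show ?thesis
  proof (cases "cmod (g 0) < 1")
    case True
    obtain k where k: "k holomorphic_on ball 0 1" "\<And>z. z \<in> ball 0 1 \<Longrightarrow> cmod (k z) \<le> 1"
      "\<And>z. z \<in> ball 0 1 \<Longrightarrow> g z = g 0 + z * k z * (1 - cnj (g 0) * g z)"
      using schur_step[OF hol bd True] by blast
    have expk: "k has_fps_expansion fps_expansion k 0"
      by (rule holomorphic_has_fps_expansion[OF k(1)]) simp
    define K where "K = fps_expansion k 0"
    have K0: "fps_nth K 0 = k 0"
      unfolding K_def using has_fps_expansion_imp_0_eq_fps_nth_0[OF expk] by simp
    have "(\<lambda>z. g 0 + z * k z * (1 - cnj (g 0) * g z)) has_fps_expansion
        fps_const (g 0) + fps_X * K * (1 - fps_const (cnj (g 0)) * fps_expansion g 0)"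
      unfolding K_def by (intro fps_expansion_intros exp expk)
    from fps_expansion_eq_on_ball[OF exp this, of 1] k(3)
    have eq: "fps_expansion g 0 = fps_const (g 0) + fps_X * (K * (1 - fps_const (cnj (g 0)) * fps_expansion g 0))"
      by (simp add: mult.assoc)
    have "G (Suc n) = fps_nth (K * (1 - fps_const (cnj (g 0)) * fps_expansion g 0)) n" for n
      unfolding G_def by (subst eq) simp
    then have "G 1 = k 0 * (1 - cnj (g 0) * G 0)"
      "G 2 = fps_nth K 1 * (1 - cnj (g 0) * G 0) - k 0 * (cnj (g 0) * G 1)"
      by (simp_all add: numeral_2_eq_2 fps_mult_nth K0 G_def)
    moreover have "cnj (g 0) * g 0 = of_real ((cmod (g 0))\<^sup>2)"
      unfolding complex_norm_square by simp
    ultimately show ?thesis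
      using that[OF k(1,2)] by (simp add: G0 K_def mult.assoc)
  next
    case False
    have "G 1 = 0 \<and> G 2 = 0"
    proof (rule bounded_holomorphic_cases[OF hol bd])
      fix c assume "cmod c = 1" "\<And>z. z \<in> ball 0 1 \<Longrightarrow> g z = c"
      then have "fps_expansion g 0 = fps_const c"
        by (intro fps_expansion_eq_on_ball[OF exp has_fps_expansion_const zero_less_one])
      then show ?thesis by (simp add: G_def)
    qed (use False in auto)
    moreover have "cmod (g 0) = 1"
      using False bd[of 0] by simp
    ultimately show ?thesis
      by (intro that[of "\<lambda>_. 0"]) (auto simp: G0)
  qed
qed

lemma schwarz_pick_coefficient:
  assumes hol: "g holomorphic_on ball 0 1"
    and bd: "\<And>z :: complex. z \<in> ball 0 1 \<Longrightarrow> cmod (g z) \<le> 1"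
  shows "cmod (fps_nth (fps_expansion g 0) 1) \<le> 1 - (cmod (g 0))\<^sup>2"
proof -
  have exp: "g has_fps_expansion fps_expansion g 0"
    by (rule holomorphic_has_fps_expansion[OF hol]) simp
  have G0: "fps_nth (fps_expansion g 0) 0 = g 0"
    using has_fps_expansion_imp_0_eq_fps_nth_0[OF exp] by simp
  have le: "(cmod (g 0))\<^sup>2 \<le> 1"
    using bd[of 0] by (simp add: abs_square_le_1)
  obtain k where "k holomorphic_on ball 0 1" and k: "\<And>z. z \<in> ball 0 1 \<Longrightarrow> cmod (k z) \<le> 1"
    "fps_nth (fps_expansion g 0) 1 = k 0 * (1 - of_real ((cmod (fps_nth (fps_expansion g 0) 0))\<^sup>2))"
    and "fps_nth (fps_expansion g 0) 2 = fps_nth (fps_expansion k 0) 1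
      * (1 - of_real ((cmod (fps_nth (fps_expansion g 0) 0))\<^sup>2))
      - k 0 * cnj (fps_nth (fps_expansion g 0) 0) * fps_nth (fps_expansion g 0) 1"
    by (rule schur_step_coefficients[OF hol bd]) blast+
  have "cmod (k 0) \<le> 1" using k(1) by simp
  moreover note k(2)[unfolded G0]
  moreover have "cmod (1 - of_real ((cmod (g 0))\<^sup>2)) = 1 - (cmod (g 0))\<^sup>2"
    using le by (metis abs_of_nonneg diff_ge_0_iff_ge norm_of_real of_real_1 of_real_diff)
  ultimately show ?thesis
    using le mult_right_mono[of "cmod (k 0)" 1 "1 - (cmod (g 0))\<^sup>2"] by (simp add: norm_mult)
qed

lemma schur_coefficients:
  assumes hol: "g holomorphic_on ball 0 1"
    and bd: "\<And>z :: complex. z \<in> ball 0 1 \<Longrightarrow> cmod (g z) \<le> 1"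
  defines "G \<equiv> fps_nth (fps_expansion g 0)"
  obtains y \<delta> where "cmod (G 0) \<le> 1" "cmod y \<le> 1" "cmod \<delta> \<le> 1 - (cmod y)\<^sup>2"
    "G 1 = y * (1 - of_real ((cmod (G 0))\<^sup>2))"
    "G 2 = (\<delta> - cnj (G 0) * y\<^sup>2) * (1 - of_real ((cmod (G 0))\<^sup>2))"
proof -
  have exp: "g has_fps_expansion fps_expansion g 0"
    by (rule holomorphic_has_fps_expansion[OF hol]) simp
  have G0: "G 0 = g 0"
    unfolding G_def using has_fps_expansion_imp_0_eq_fps_nth_0[OF exp] by simp
  obtain k where k: "k holomorphic_on ball 0 1" "\<And>z. z \<in> ball 0 1 \<Longrightarrow> cmod (k z) \<le> 1"
    "G 1 = k 0 * (1 - of_real ((cmod (G 0))\<^sup>2))"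
    "G 2 = fps_nth (fps_expansion k 0) 1 * (1 - of_real ((cmod (G 0))\<^sup>2)) - k 0 * cnj (G 0) * G 1"
    unfolding G_def by (rule schur_step_coefficients[OF hol bd]) auto
  show ?thesis
  proof (rule that[of "k 0" "fps_nth (fps_expansion k 0) 1"])
    show "cmod (G 0) \<le> 1" using G0 bd by simp
    show "G 2 = (fps_nth (fps_expansion k 0) 1 - cnj (G 0) * (k 0)\<^sup>2) * (1 - of_real ((cmod (G 0))\<^sup>2))"
      unfolding k(4) k(3) by (simp add: algebra_simps power2_eq_square)
  qed (use k schwarz_pick_coefficient[OF k(1,2)] in auto)
qed

section \<open>The second Hankel determinant\<close>

lemma hankel_real_inequality:
  fixes c t :: real
  assumes c: "0 \<le> c" "c \<le> 1" and t: "0 \<le> t" "t \<le> 1"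
  shows "(1 - c\<^sup>2) * (4 * c * (1 - t\<^sup>2) + (3 + c\<^sup>2) * t\<^sup>2 + 2 * c\<^sup>2 * t) + 3 * c ^ 4 \<le> 3"
proof -
  have c2: "c\<^sup>2 \<le> 1" and t2: "t\<^sup>2 \<le> 1"
    using c t by (simp_all add: power_le_one)
  have "0 \<le> (1 - t\<^sup>2) * ((1 - c) * (3 - c)) + 2 * c\<^sup>2 * (1 - t)"
    using c t t2 by (intro add_nonneg_nonneg mult_nonneg_nonneg) auto
  then have "4 * c * (1 - t\<^sup>2) + (3 + c\<^sup>2) * t\<^sup>2 + 2 * c\<^sup>2 * t \<le> 3 + 3 * c\<^sup>2"
    by (simp add: algebra_simps power2_eq_square)
  then have "(1 - c\<^sup>2) * (4 * c * (1 - t\<^sup>2) + (3 + c\<^sup>2) * t\<^sup>2 + 2 * c\<^sup>2 * t) \<le> (1 - c\<^sup>2) * (3 + 3 * c\<^sup>2)"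
    using c2 by (intro mult_left_mono) auto
  also have "\<dots> = 3 - 3 * c ^ 4"
    by (simp add: algebra_simps power2_eq_square power4_eq_xxxx)
  finally show ?thesis by simp
qed

lemma hankel_schur_bound:
  fixes b y \<delta> :: complex and \<beta> :: real
  assumes b: "cmod b \<le> 1" and y: "cmod y \<le> 1" and \<delta>: "cmod \<delta> \<le> 1 - (cmod y)\<^sup>2"
    and \<beta>: "0 \<le> \<beta>" "\<beta> \<le> 1"
  defines "s \<equiv> 1 - complex_of_real ((cmod b)\<^sup>2)"
  shows "cmod (4 * b * ((\<delta> - cnj b * y\<^sup>2) * s) + 2 * b\<^sup>2 * (y * s) - 3 * (y * s)\<^sup>2
    + (1 - 4 * of_real (\<beta>\<^sup>2)) * b ^ 4) \<le> 3"
proof -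
  define c where "c = cmod b"
  define t where "t = cmod y"
  have c: "0 \<le> c" "c \<le> 1" and t: "0 \<le> t" "t \<le> 1"
    using b y by (auto simp: c_def t_def)
  have c2: "0 \<le> 1 - c\<^sup>2"
    using c by (simp add: power_le_one)
  have \<beta>2: "\<beta>\<^sup>2 \<le> 1" using \<beta> by (simp add: power_le_one)
  have bb: "b * cnj b = of_real (c\<^sup>2)"
    unfolding c_def complex_norm_square by simp
  have s: "s = of_real (1 - c\<^sup>2)" by (simp add: s_def c_def)
  have "4 * b * ((\<delta> - cnj b * y\<^sup>2) * s) - 3 * (y * s)\<^sup>2
      = s * (4 * b * \<delta>) - s * (of_real (4 * c\<^sup>2 + 3 * (1 - c\<^sup>2)) * y\<^sup>2)"
    unfolding s using bb by simp algebra
  then have eq: "4 * b * ((\<delta> - cnj b * y\<^sup>2) * s) + 2 * b\<^sup>2 * (y * s) - 3 * (y * s)\<^sup>2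
    + (1 - 4 * of_real (\<beta>\<^sup>2)) * b ^ 4
    = of_real (1 - c\<^sup>2) * (4 * b * \<delta> - of_real (3 + c\<^sup>2) * y\<^sup>2 + 2 * b\<^sup>2 * y) + of_real (1 - 4 * \<beta>\<^sup>2) * b ^ 4"
    by (simp add: s algebra_simps)
  have "cmod (of_real (1 - c\<^sup>2) * (4 * b * \<delta> - of_real (3 + c\<^sup>2) * y\<^sup>2 + 2 * b\<^sup>2 * y)
      + of_real (1 - 4 * \<beta>\<^sup>2) * b ^ 4)
    \<le> (1 - c\<^sup>2) * (4 * c * (1 - t\<^sup>2) + (3 + c\<^sup>2) * t\<^sup>2 + 2 * c\<^sup>2 * t) + 3 * c ^ 4"
  proof (intro order_trans[OF norm_triangle_ineq] add_mono)
    have "cmod (4 * b * \<delta>) \<le> 4 * c * (1 - t\<^sup>2)"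
      using \<delta> by (auto simp: norm_mult c_def t_def intro!: mult_left_mono)
    moreover have "cmod (of_real (3 + c\<^sup>2) * y\<^sup>2) = (3 + c\<^sup>2) * t\<^sup>2"
      unfolding norm_mult norm_of_real by (simp add: norm_power t_def)
    moreover have "cmod (2 * b\<^sup>2 * y) = 2 * c\<^sup>2 * t"
      by (simp add: norm_mult norm_power c_def t_def)
    ultimately have "cmod (4 * b * \<delta> - of_real (3 + c\<^sup>2) * y\<^sup>2 + 2 * b\<^sup>2 * y)
        \<le> 4 * c * (1 - t\<^sup>2) + (3 + c\<^sup>2) * t\<^sup>2 + 2 * c\<^sup>2 * t"
      using norm_triangle_ineq[of "4 * b * \<delta> - of_real (3 + c\<^sup>2) * y\<^sup>2" "2 * b\<^sup>2 * y"]
        norm_triangle_ineq4[of "4 * b * \<delta>" "of_real (3 + c\<^sup>2) * y\<^sup>2"] by linarith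
    then show "cmod (of_real (1 - c\<^sup>2) * (4 * b * \<delta> - of_real (3 + c\<^sup>2) * y\<^sup>2 + 2 * b\<^sup>2 * y))
        \<le> (1 - c\<^sup>2) * (4 * c * (1 - t\<^sup>2) + (3 + c\<^sup>2) * t\<^sup>2 + 2 * c\<^sup>2 * t)"
      unfolding norm_mult norm_of_real using c2 by (simp add: mult_left_mono)
    have "\<bar>1 - 4 * \<beta>\<^sup>2\<bar> \<le> 3" using \<beta>2 zero_le_power2[of \<beta>] unfolding abs_le_iff by linarith
    then show "cmod (of_real (1 - 4 * \<beta>\<^sup>2) * b ^ 4) \<le> 3 * c ^ 4"
      unfolding norm_mult norm_of_real norm_power c_def by (intro mult_right_mono) auto
  qed
  then show ?thesis
    unfolding eq using hankel_real_inequality[OF c t] by (rule order_trans)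
qed

lemma starlike_hankel_bound:
  fixes p :: "complex \<Rightarrow> complex" and \<alpha> :: real
  assumes hol: "p holomorphic_on ball 0 1" and p0: "p 0 = 1"
    and \<alpha>: "0 \<le> \<alpha>" "\<alpha> < 1"
    and Re: "\<And>z. z \<in> ball 0 1 \<Longrightarrow> Re (p z) > \<alpha> * (cmod (p z))\<^sup>2"
  defines "P \<equiv> fps_nth (fps_expansion p 0)"
  assumes a2: "P 1 + a2 = 0" and a3: "P 2 + 2 * a2 * P 1 + 2 * a3 = 0"
    and a4: "P 3 + 2 * a2 * P 2 + 3 * a3 * P 1 + 3 * a4 = 0"
  shows "cmod (a2 * a4 - a3\<^sup>2) \<le> (1 - \<alpha>)\<^sup>2"
proof -
  define \<beta> where "\<beta> = 1 - \<alpha>"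
  define \<gamma> where "\<gamma> = complex_of_real (2 * \<beta> - 1)"
  define w where "w z = (1 - p z) / (1 + \<gamma> * p z)" for z
  have lt: "cmod (1 - p z) < cmod (1 + \<gamma> * p z)" if "z \<in> ball 0 1" for z
  proof -
    have "(cmod (1 + \<gamma> * p z))\<^sup>2 - (cmod (1 - p z))\<^sup>2 = 4 * \<beta> * (Re (p z) - \<alpha> * (cmod (p z))\<^sup>2)"
      unfolding cmod_power2 by (simp add: \<gamma>_def \<beta>_def algebra_simps power2_eq_square)
    moreover have "4 * \<beta> * (Re (p z) - \<alpha> * (cmod (p z))\<^sup>2) > 0"
      using Re[OF that] \<alpha> by (intro mult_pos_pos) (auto simp: \<beta>_def)
    ultimately have "(cmod (1 - p z))\<^sup>2 < (cmod (1 + \<gamma> * p z))\<^sup>2" by simp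
    then show ?thesis by (rule power_less_imp_less_base) simp
  qed
  have ne: "1 + \<gamma> * p z \<noteq> 0" if "z \<in> ball 0 1" for z
    using lt[OF that] by auto
  have holw: "w holomorphic_on ball 0 1"
    unfolding w_def[abs_def] using ne by (intro holomorphic_intros hol) auto
  have w0: "w 0 = 0" by (simp add: w_def p0)
  have ltw: "cmod (w z) < 1" if "norm z < 1" for z
    using lt[of z] ne[of z] that by (simp add: w_def norm_divide divide_less_eq)
  obtain g where g: "g holomorphic_on ball 0 1" "\<And>z. norm z < 1 \<Longrightarrow> w z = z * g z" "deriv w 0 = g 0"
    using Schwarz3[OF holw w0] by blast
  have gle: "cmod (g z) \<le> 1" if z: "z \<in> ball 0 1" for z
  proof (cases "z = 0")
    case True
    then show ?thesis using Schwarz_Lemma(2)[OF holw w0 ltw, of 0] g(3) by simp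
  next
    case False
    then show ?thesis
      using Schwarz_Lemma(1)[OF holw w0 ltw, of z] g(2)[of z] z by (simp add: norm_mult)
  qed
  define G where "G = fps_nth (fps_expansion g 0)"
  have expp: "p has_fps_expansion fps_expansion p 0" and expg: "g has_fps_expansion fps_expansion g 0"
    by (rule holomorphic_has_fps_expansion[OF hol], simp)
      (rule holomorphic_has_fps_expansion[OF g(1)], simp)
  have P0: "P 0 = 1"
    unfolding P_def using has_fps_expansion_imp_0_eq_fps_nth_0[OF expp] p0 by simp
  have "(\<lambda>z. z * (g z * (1 + \<gamma> * p z))) has_fps_expansion
      fps_X * (fps_expansion g 0 * (1 + fps_const \<gamma> * fps_expansion p 0))"
    by (intro fps_expansion_intros expp expg)
  moreover have "(\<lambda>z. 1 - p z) has_fps_expansion 1 - fps_expansion p 0"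
    by (intro fps_expansion_intros expp)
  ultimately have eq: "fps_X * (fps_expansion g 0 * (1 + fps_const \<gamma> * fps_expansion p 0)) = 1 - fps_expansion p 0"
  proof (rule fps_expansion_eq_on_ball[of _ _ _ _ 1])
    fix z :: complex assume z: "z \<in> ball 0 1"
    then show "z * (g z * (1 + \<gamma> * p z)) = 1 - p z"
      using g(2)[of z] ne[OF z] by (simp add: w_def field_simps)
  qed simp
  have coeff: "fps_nth (fps_expansion g 0 * (1 + fps_const \<gamma> * fps_expansion p 0)) n = - P (Suc n)" for n
    using arg_cong[OF eq, of "\<lambda>F. fps_nth F (Suc n)"] by (simp add: P_def)
  have \<gamma>: "\<gamma> = 2 * of_real \<beta> - 1" by (simp add: \<gamma>_def)
  have P1: "P 1 = - (2 * of_real \<beta> * G 0)"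
    and P2: "P 2 = - (2 * of_real \<beta> * G 1 + G 0 * \<gamma> * P 1)"
    and P3: "P 3 = - (2 * of_real \<beta> * G 2 + G 1 * \<gamma> * P 1 + G 0 * \<gamma> * P 2)"
    using coeff[of 0] coeff[of 1] coeff[of 2] P0
    by (simp_all add: fps_mult_nth G_def P_def \<gamma> numeral_2_eq_2 numeral_3_eq_3 algebra_simps
        eq_neg_iff_add_eq_0)
  obtain y \<delta> where S: "cmod (G 0) \<le> 1" "cmod y \<le> 1" "cmod \<delta> \<le> 1 - (cmod y)\<^sup>2"
    "G 1 = y * (1 - of_real ((cmod (G 0))\<^sup>2))"
    "G 2 = (\<delta> - cnj (G 0) * y\<^sup>2) * (1 - of_real ((cmod (G 0))\<^sup>2))"
    unfolding G_def by (rule schur_coefficients[OF g(1) gle]) auto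
  have a2': "a2 = 2 * of_real \<beta> * G 0"
    using a2 P1 by algebra
  have a3': "a3 = of_real \<beta> * G 1 + of_real \<beta> * (2 * of_real \<beta> + 1) * (G 0)\<^sup>2"
  proof -
    have "2 * a3 = - P 2 - 2 * a2 * P 1" using a3 by algebra
    also have "\<dots> = 2 * (of_real \<beta> * G 1 + of_real \<beta> * (2 * of_real \<beta> + 1) * (G 0)\<^sup>2)"
      unfolding P2 P1 a2' \<gamma> by algebra
    finally show ?thesis by (simp only: mult_cancel_left) simp
  qed
  have "3 * (a2 * a4 - a3\<^sup>2) = of_real (\<beta>\<^sup>2) * (4 * G 0 * G 2 + 2 * (G 0)\<^sup>2 * G 1 - 3 * (G 1)\<^sup>2
      + (1 - 4 * of_real (\<beta>\<^sup>2)) * G 0 ^ 4)"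
  proof -
    have "3 * a4 = - P 3 - 2 * a2 * P 2 - 3 * a3 * P 1" using a4 by algebra
    then have "3 * (a2 * a4 - a3\<^sup>2) = a2 * (- P 3 - 2 * a2 * P 2 - 3 * a3 * P 1) - 3 * a3\<^sup>2"
      by algebra
    also have "\<dots> = of_real (\<beta>\<^sup>2) * (4 * G 0 * G 2 + 2 * (G 0)\<^sup>2 * G 1 - 3 * (G 1)\<^sup>2
      + (1 - 4 * of_real (\<beta>\<^sup>2)) * G 0 ^ 4)"
      unfolding P3 P2 P1 a3' a2' \<gamma> of_real_power by algebra
    finally show ?thesis .
  qed
  also have "cmod \<dots> \<le> \<beta>\<^sup>2 * 3"
    unfolding norm_mult[of "of_real (\<beta>\<^sup>2)"] S(4,5)
    unfolding norm_of_real
    using hankel_schur_bound[OF S(1-3), of \<beta>] \<alpha>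
    by (intro mult_mono) (simp_all add: \<beta>_def del: of_real_diff of_real_power)
  finally show ?thesis
    unfolding norm_mult[of 3] by (simp add: \<beta>_def)
qed

section \<open>Taylor expansion along complex lines\<close>

lemma norm_le_power_of_derivative:
  fixes g :: "complex \<Rightarrow> 'b::complex_banach"
  assumes der: "\<And>z. z \<in> ball 0 \<delta> \<Longrightarrow> (g has_derivative (\<lambda>w. w *\<^sub>C g' z)) (at z)"
    and bd: "\<And>z. z \<in> ball 0 \<delta> \<Longrightarrow> norm (g' z) \<le> C * cmod z ^ n"
    and g0: "g 0 = 0" and z: "z \<in> ball 0 \<delta>"
  shows "norm (g z) \<le> C * cmod z ^ Suc n"
proof (cases "z = 0")
  case False
  have "0 \<le> C * cmod z ^ n"
    using bd[OF z] norm_ge_zero order_trans by blast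
  moreover have "0 < cmod z ^ n" using False by simp
  ultimately have C: "C \<ge> 0"
    using zero_le_mult_iff not_le by metis
  have "norm (g z - g 0) \<le> (C * cmod z ^ n) * cmod (z - 0)"
  proof (rule differentiable_bound[where S = "cball 0 (cmod z)"])
    fix x assume x: "x \<in> cball (0 :: complex) (cmod z)"
    then have x': "x \<in> ball 0 \<delta>" using z by simp
    show "(g has_derivative (\<lambda>w. w *\<^sub>C g' x)) (at x within cball 0 (cmod z))"
      by (rule has_derivative_at_withinI[OF der[OF x']])
    have "norm (g' x) \<le> C * cmod z ^ n"
      using x C by (intro order_trans[OF bd[OF x']] mult_left_mono power_mono) auto
    then show "onorm (\<lambda>w. w *\<^sub>C g' x) \<le> C * cmod z ^ n"
      using C by (intro onorm_bound)
        (auto simp: norm_scaleC mult.commute[of "C * cmod z ^ n"] intro!: mult_left_mono)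
  qed auto
  then show ?thesis by (simp add: g0 mult_ac)
qed (simp add: g0)

lemma vector_taylor_bound:
  fixes f :: "nat \<Rightarrow> complex \<Rightarrow> 'b::complex_banach"
  assumes "\<And>k z. k < n \<Longrightarrow> z \<in> ball 0 \<delta> \<Longrightarrow> (f k has_derivative (\<lambda>w. w *\<^sub>C f (Suc k) z)) (at z)"
    and "\<And>z. z \<in> ball 0 \<delta> \<Longrightarrow> norm (f n z - f n 0) \<le> C * cmod z"
    and "z \<in> ball 0 \<delta>"
  shows "norm (f 0 z - (\<Sum>i\<le>n. (z ^ i / fact i) *\<^sub>C f i 0)) \<le> C * cmod z ^ Suc n"
  using assms
proof (induction n arbitrary: f z)
  case 0
  then show ?case by simp
next
  case (Suc n)
  let ?g' = "\<lambda>z. f 1 z - (\<Sum>i\<le>n. (z ^ i / fact i) *\<^sub>C f (Suc i) 0)"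
  show ?case
  proof (rule norm_le_power_of_derivative[where g' = ?g'])
    fix z assume z: "z \<in> ball (0 :: complex) \<delta>"
    have "((\<lambda>z. (z ^ Suc i / fact (Suc i)) *\<^sub>C f (Suc i) 0) has_derivative
        (\<lambda>w. w *\<^sub>C (z ^ i / fact i) *\<^sub>C f (Suc i) 0)) (at z)" for i
    proof -
      have "((\<lambda>z. z ^ Suc i / fact (Suc i)) has_field_derivative (z ^ i / fact i)) (at z)"
      proof -
        have "((\<lambda>z. z ^ Suc i) has_field_derivative of_nat (Suc i) * z ^ i) (at z)"
          using DERIV_power[OF DERIV_ident, of "Suc i" z] by simp
        then have "((\<lambda>z. z ^ Suc i / fact (Suc i)) has_field_derivative
            of_nat (Suc i) * z ^ i / fact (Suc i)) (at z)"
          by (rule DERIV_cdivide)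
        then show ?thesis by (simp del: of_nat_Suc power_Suc)
      qed
      then have "((\<lambda>z. z ^ Suc i / fact (Suc i)) has_derivative (\<lambda>w. w * (z ^ i / fact i))) (at z)"
        unfolding has_field_derivative_def
        by (rule has_derivative_eq_rhs) (simp add: fun_eq_iff mult.commute)
      from bounded_linear.has_derivative[OF scaleC.bounded_linear_left this]
      show ?thesis by (simp add: scaleC_scaleC)
    qed
    then have "((\<lambda>z. f 0 z - (f 0 0 + (\<Sum>i\<le>n. (z ^ Suc i / fact (Suc i)) *\<^sub>C f (Suc i) 0))) has_derivative
        (\<lambda>w. w *\<^sub>C f (Suc 0) z - (0 + (\<Sum>i\<le>n. w *\<^sub>C (z ^ i / fact i) *\<^sub>C f (Suc i) 0)))) (at z)"
      using Suc.prems(1)[of 0 z] z by (intro has_derivative_diff has_derivative_add has_derivative_sum) auto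
    then show "((\<lambda>z. f 0 z - (\<Sum>i\<le>Suc n. (z ^ i / fact i) *\<^sub>C f i 0)) has_derivative (\<lambda>w. w *\<^sub>C ?g' z)) (at z)"
      unfolding sum.atMost_Suc_shift by (simp add: scaleC.diff_right scaleC.sum_right)
    show "norm (?g' z) \<le> C * cmod z ^ Suc n"
      using Suc.IH[of "\<lambda>k. f (Suc k)" z] Suc.prems(1,2) z by simp
  next
    show "f 0 0 - (\<Sum>i\<le>Suc n. (0 ^ i / fact i) *\<^sub>C f i 0) = 0"
      unfolding sum.atMost_Suc_shift by simp
  qed (use Suc.prems in auto)
qed

lemma has_derivative_blinfun_apply_slice:
  fixes A :: "complex \<Rightarrow> 'a::complex_banach \<Rightarrow>\<^sub>L 'b::complex_banach"
  assumes "(A has_derivative (\<lambda>w. w *\<^sub>C B)) (at z)"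
  shows "((\<lambda>z. blinfun_apply (A z) v) has_derivative (\<lambda>w. w *\<^sub>C blinfun_apply B v)) (at z)"
  using bounded_linear.has_derivative[OF blinfun.bounded_linear_left assms, of v] by simp

lemma iterated_frechet_slices:
  fixes F :: "'a::complex_banach \<Rightarrow> 'a"
  assumes F: "complex_differentiable_on F S" and S: "open S" and z: "z *\<^sub>C x \<in> S"
  shows "((\<lambda>z. F (z *\<^sub>C x)) has_derivative (\<lambda>w. w *\<^sub>C blinfun_apply (frechet F (z *\<^sub>C x)) x)) (at z)"
    "((\<lambda>z. blinfun_apply (frechet F (z *\<^sub>C x)) x) has_derivative
        (\<lambda>w. w *\<^sub>C frechet_diag2 F (z *\<^sub>C x) x)) (at z)"
    "((\<lambda>z. frechet_diag2 F (z *\<^sub>C x) x) has_derivative (\<lambda>w. w *\<^sub>C frechet_diag3 F (z *\<^sub>C x) x)) (at z)"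
    "((\<lambda>z. frechet_diag3 F (z *\<^sub>C x) x) has_derivative (\<lambda>w. w *\<^sub>C frechet_diag4 F (z *\<^sub>C x) x)) (at z)"
    "\<exists>d. ((\<lambda>z. frechet_diag4 F (z *\<^sub>C x) x) has_derivative (\<lambda>w. w *\<^sub>C d)) (at z)"
proof -
  note F1 = complex_differentiable_on_frechet[OF F S]
  note F2 = complex_differentiable_on_frechet[OF F1 S]
  note F3 = complex_differentiable_on_frechet[OF F2 S]
  note F4 = complex_differentiable_on_frechet[OF F3 S]
  show "((\<lambda>z. F (z *\<^sub>C x)) has_derivative (\<lambda>w. w *\<^sub>C blinfun_apply (frechet F (z *\<^sub>C x)) x)) (at z)"
    using has_derivative_slice[OF F, of 0 z x] z by simp
  show "((\<lambda>z. blinfun_apply (frechet F (z *\<^sub>C x)) x) has_derivative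
        (\<lambda>w. w *\<^sub>C frechet_diag2 F (z *\<^sub>C x) x)) (at z)"
    using has_derivative_slice[OF F1, of 0 z x] z
    unfolding frechet_diag2_def by (intro has_derivative_blinfun_apply_slice) simp
  show "((\<lambda>z. frechet_diag2 F (z *\<^sub>C x) x) has_derivative (\<lambda>w. w *\<^sub>C frechet_diag3 F (z *\<^sub>C x) x)) (at z)"
    using has_derivative_slice[OF F2, of 0 z x] z
    unfolding frechet_diag2_def frechet_diag3_def by (intro has_derivative_blinfun_apply_slice) simp
  show "((\<lambda>z. frechet_diag3 F (z *\<^sub>C x) x) has_derivative (\<lambda>w. w *\<^sub>C frechet_diag4 F (z *\<^sub>C x) x)) (at z)"
    using has_derivative_slice[OF F3, of 0 z x] z
    unfolding frechet_diag3_def frechet_diag4_def by (intro has_derivative_blinfun_apply_slice) simp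
  have "((\<lambda>z. frechet_diag4 F (z *\<^sub>C x) x) has_derivative
      (\<lambda>w. w *\<^sub>C blinfun_apply (blinfun_apply (blinfun_apply (blinfun_apply (blinfun_apply
        (frechet (frechet (frechet (frechet (frechet F)))) (z *\<^sub>C x)) x) x) x) x) x)) (at z)"
    using has_derivative_slice[OF F4, of 0 z x] z
    unfolding frechet_diag4_def by (intro has_derivative_blinfun_apply_slice) simp
  then show "\<exists>d. ((\<lambda>z. frechet_diag4 F (z *\<^sub>C x) x) has_derivative (\<lambda>w. w *\<^sub>C d)) (at z)"
    by blast
qed

lemma has_derivative_imp_lipschitz_at:
  fixes f :: "'a::real_normed_vector \<Rightarrow> 'b::real_normed_vector"
  assumes "(f has_derivative D) (at x)"
  obtains \<delta> C where "\<delta> > 0" "\<And>y. dist y x < \<delta> \<Longrightarrow> norm (f y - f x) \<le> C * norm (y - x)"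
proof -
  obtain K where K: "\<And>h. norm (D h) \<le> norm h * K"
    using bounded_linear.bounded[OF has_derivative_bounded_linear[OF assms]] by blast
  obtain d where d: "d > 0" "\<And>y. norm (y - x) < d \<Longrightarrow> norm (f y - f x - D (y - x)) \<le> 1 * norm (y - x)"
    using assms unfolding has_derivative_at_alt by (metis zero_less_one)
  have "norm (f y - f x) \<le> (1 + K) * norm (y - x)" if "dist y x < d" for y
    using d(2)[of y] K[of "y - x"] that norm_triangle_ineq[of "f y - f x - D (y - x)" "D (y - x)"]
    by (simp add: dist_norm algebra_simps)
  then show ?thesis using that d by blast
qed

lemma holomorphic_taylor_slice:
  fixes F :: "'a::complex_banach \<Rightarrow> 'a"
  assumes F: "complex_differentiable_on F S" and S: "open S" "0 \<in> S"
  obtains \<delta> C where "\<delta> > 0"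
    "\<And>z. z \<in> ball 0 \<delta> \<Longrightarrow> norm (F (z *\<^sub>C x) - (F 0 + z *\<^sub>C blinfun_apply (frechet F 0) x
      + (z\<^sup>2 / 2) *\<^sub>C frechet_diag2 F 0 x + (z ^ 3 / 6) *\<^sub>C frechet_diag3 F 0 x
      + (z ^ 4 / 24) *\<^sub>C frechet_diag4 F 0 x)) \<le> C * cmod z ^ 5"
    "\<And>z. z \<in> ball 0 \<delta> \<Longrightarrow> norm (blinfun_apply (frechet F (z *\<^sub>C x)) x
      - (blinfun_apply (frechet F 0) x + z *\<^sub>C frechet_diag2 F 0 x + (z\<^sup>2 / 2) *\<^sub>C frechet_diag3 F 0 x
      + (z ^ 3 / 6) *\<^sub>C frechet_diag4 F 0 x)) \<le> C * cmod z ^ 4"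
proof -
  define f where "f k = (if k = 0 then \<lambda>z. F (z *\<^sub>C x) else if k = 1 then \<lambda>z. blinfun_apply (frechet F (z *\<^sub>C x)) x
    else if k = 2 then \<lambda>z. frechet_diag2 F (z *\<^sub>C x) x else if k = 3 then \<lambda>z. frechet_diag3 F (z *\<^sub>C x) x
    else (\<lambda>z. frechet_diag4 F (z *\<^sub>C x) x))" for k :: nat
  obtain e where e: "e > 0" "ball 0 e \<subseteq> S"
    using S open_contains_ball by blast
  have n: "norm x + 1 > 0" using norm_ge_zero[of x] by linarith
  obtain d where "(f 4 has_derivative (\<lambda>w. w *\<^sub>C d)) (at 0)"
    using iterated_frechet_slices(5)[OF F S(1), of 0 x] S(2) by (auto simp: f_def)
  then obtain \<delta>' C where \<delta>': "\<delta>' > 0"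
    and C: "\<And>z. dist z 0 < \<delta>' \<Longrightarrow> norm (f 4 z - f 4 0) \<le> C * norm (z - 0)"
    by (rule has_derivative_imp_lipschitz_at) blast
  define \<delta> where "\<delta> = min \<delta>' (e / (norm x + 1))"
  have \<delta>: "\<delta> > 0" using \<delta>' e n by (simp add: \<delta>_def)
  have inS: "z *\<^sub>C x \<in> S" if "z \<in> ball 0 \<delta>" for z
  proof -
    have "cmod z < e / (norm x + 1)" using that by (simp add: \<delta>_def)
    then have "cmod z * (norm x + 1) < e" using n by (simp add: field_simps)
    moreover have "cmod z * norm x \<le> cmod z * (norm x + 1)" by (intro mult_left_mono) auto
    ultimately have "norm (z *\<^sub>C x) < e" by (simp add: norm_scaleC)
    then show ?thesis using e by auto
  qed
  have der: "(f k has_derivative (\<lambda>w. w *\<^sub>C f (Suc k) z)) (at z)" if k: "k < 4" and z: "z \<in> ball 0 \<delta>" for k z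
  proof -
    have "k = 0 \<or> k = 1 \<or> k = 2 \<or> k = 3" using k by auto
    then show ?thesis
      using iterated_frechet_slices(1-4)[OF F S(1) inS[OF z]] by (auto simp: f_def)
  qed
  have last: "norm (f 4 z - f 4 0) \<le> C * cmod z" if "z \<in> ball 0 \<delta>" for z
    using C[of z] that by (simp add: \<delta>_def)
  have "norm (f 0 z - (\<Sum>i\<le>4. (z ^ i / fact i) *\<^sub>C f i 0)) \<le> C * cmod z ^ Suc 4" if "z \<in> ball 0 \<delta>" for z
    by (rule vector_taylor_bound[where \<delta> = \<delta>]) (use der last that in auto)
  moreover have "norm (f (Suc 0) z - (\<Sum>i\<le>3. (z ^ i / fact i) *\<^sub>C f (Suc i) 0)) \<le> C * cmod z ^ Suc 3"
    if "z \<in> ball 0 \<delta>" for z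
    by (rule vector_taylor_bound[where \<delta> = \<delta> and f = "\<lambda>k. f (Suc k)"]) (use der last that in auto)
  ultimately show ?thesis
    by (intro that[OF \<delta>, of C]) (simp_all add: f_def eval_nat_numeral fact_numeral)
qed

section \<open>The vector field of a locally biholomorphic map\<close>

lemma inv_deriv_apply_eq:
  assumes "G o\<^sub>L frechet F x = id_blinfun" "frechet F x o\<^sub>L G = id_blinfun"
  shows "inv_deriv_apply F x = blinfun_apply G (F x)"
proof -
  have "blinfun_apply G (blinfun_apply (frechet F x) y) = y" for y
    using arg_cong[OF assms(1), of "\<lambda>A. blinfun_apply A y"] by simp
  moreover have "blinfun_apply (frechet F x) (blinfun_apply G y) = y" for y
    using arg_cong[OF assms(2), of "\<lambda>A. blinfun_apply A y"] by simp
  ultimately have "inv (blinfun_apply (frechet F x)) = blinfun_apply G"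
    by (intro inv_equality) auto
  then show ?thesis by (simp add: inv_deriv_apply_def)
qed

context
  fixes F :: "'a::complex_banach \<Rightarrow> 'a" and G :: "'a \<Rightarrow> 'a \<Rightarrow>\<^sub>L 'a"
  assumes hol: "complex_differentiable_on F (ball 0 1)"
    and G: "\<And>x. x \<in> ball 0 1 \<Longrightarrow> G x o\<^sub>L frechet F x = id_blinfun"
      "\<And>x. x \<in> ball 0 1 \<Longrightarrow> frechet F x o\<^sub>L G x = id_blinfun"
begin

private lemma G_app:
  assumes "x \<in> ball 0 1"
  shows "blinfun_apply (G x) (blinfun_apply (frechet F x) y) = y"
    "blinfun_apply (frechet F x) (blinfun_apply (G x) y) = y"
  using arg_cong[OF G(1)[OF assms], of "\<lambda>A. blinfun_apply A y"]
    arg_cong[OF G(2)[OF assms], of "\<lambda>A. blinfun_apply A y"] by simp_all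

lemma complex_linear_inverse_frechet:
  assumes x: "x \<in> ball 0 1"
  shows "complex_linear (blinfun_apply (G x))"
  unfolding complex_linear_def
proof (intro conjI allI)
  fix c y
  have "blinfun_apply (G x) (c *\<^sub>C y) = blinfun_apply (G x) (c *\<^sub>C blinfun_apply (frechet F x) (blinfun_apply (G x) y))"
    using G_app[OF x] by simp
  also have "\<dots> = blinfun_apply (G x) (blinfun_apply (frechet F x) (c *\<^sub>C blinfun_apply (G x) y))"
    using complex_linearD(2)[OF complex_differentiable_onD(2)[OF hol x]] by simp
  also have "\<dots> = c *\<^sub>C blinfun_apply (G x) y"
    using G_app[OF x] by simp
  finally show "blinfun_apply (G x) (c *\<^sub>C y) = c *\<^sub>C blinfun_apply (G x) y" .
qed (simp add: blinfun.add_right)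

lemma inverse_frechet_tendsto:
  assumes x: "x \<in> ball 0 1"
  shows "(G \<longlongrightarrow> G x) (at x)"
proof -
  let ?D = "frechet F"
  have "continuous (at x) ?D"
    using complex_differentiable_onD(1)[OF complex_differentiable_on_frechet[OF hol open_ball] x]
      has_derivative_continuous by blast
  then have D: "(?D \<longlongrightarrow> ?D x) (at x)" by (simp add: continuous_at)
  have eq: "norm (G y - G x) \<le> norm (G y) * norm (?D x - ?D y) * norm (G x)" if y: "y \<in> ball 0 1" for y
  proof -
    have "G y - G x = G y o\<^sub>L ((?D x - ?D y) o\<^sub>L G x)"
      using G_app[OF x] G_app[OF y] by (intro blinfun_eqI) (simp add: blinfun.bilinear_simps)
    also have "norm \<dots> \<le> norm (G y) * (norm (?D x - ?D y) * norm (G x))"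
      by (intro order_trans[OF norm_blinfun_compose] mult_left_mono norm_blinfun_compose) auto
    finally show ?thesis by (simp add: mult.assoc)
  qed
  have lim: "((\<lambda>y. norm (?D x - ?D y) * norm (G x)) \<longlongrightarrow> 0) (at x)"
    using tendsto_mult_left_zero[OF tendsto_norm_zero[OF LIM_zero[OF D]], of "norm (G x)"]
    by (simp add: norm_minus_commute)
  have inb: "\<forall>\<^sub>F y in at x. y \<in> ball 0 1"
    using x by (intro eventually_at_in_open') auto
  have small: "\<forall>\<^sub>F y in at x. norm (?D x - ?D y) * norm (G x) < 1 / 2"
    using lim by (intro order_tendstoD) auto
  have "((\<lambda>y. G y - G x) \<longlongrightarrow> 0) (at x)"
  proof (rule Lim_null_comparison)
    show "\<forall>\<^sub>F y in at x. norm (G y - G x) \<le> 2 * norm (G x) * (norm (?D x - ?D y) * norm (G x))"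
      using inb small
    proof eventually_elim
      case (elim y)
      let ?q = "norm (?D x - ?D y) * norm (G x)"
      have "norm (G y) * ?q \<le> norm (G y) * (1 / 2)"
        using elim(2) by (intro mult_left_mono) auto
      moreover have "norm (G y) \<le> norm (G x) + norm (G y - G x)"
        using norm_triangle_ineq[of "G x" "G y - G x"] by simp
      ultimately have "norm (G y) \<le> 2 * norm (G x)"
        using eq[OF elim(1)] by (simp add: mult.assoc)
      then have "norm (G y) * ?q \<le> 2 * norm (G x) * ?q"
        by (rule mult_right_mono) simp
      then show ?case using eq[OF elim(1)] by (simp add: mult.assoc)
    qed
    show "((\<lambda>y. 2 * norm (G x) * (norm (?D x - ?D y) * norm (G x))) \<longlongrightarrow> 0) (at x)"
      by (rule tendsto_mult_right_zero[OF lim])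
  qed
  then show ?thesis by (rule LIM_zero_cancel)
qed

text \<open>Writing \<open>h(y) = DF(y)\<^sup>-\<^sup>1F(y)\<close>, one has \<open>h(y) - h(x) = DF(y)\<^sup>-\<^sup>1(F(y) - DF(y)h(x))\<close>, and the
  vector on the right vanishes at \<open>y = x\<close>; continuity of the inverse therefore suffices.\<close>

lemma complex_differentiable_on_inverse_apply:
  "complex_differentiable_on (\<lambda>x. blinfun_apply (G x) (F x)) (ball 0 1)"
  unfolding complex_differentiable_on_def
proof
  fix x :: 'a assume x: "x \<in> ball 0 1"
  let ?D = "frechet F"
  define h where "h y = blinfun_apply (G y) (F y)" for y
  define u where "u y = F y - blinfun_apply (?D y) (h x)" for y
  define L where "L v = blinfun_apply (?D x) v - blinfun_apply (blinfun_apply (frechet ?D x) v) (h x)" for v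
  note DF = complex_differentiable_onD[OF hol x]
  note DDF = complex_differentiable_onD[OF complex_differentiable_on_frechet[OF hol open_ball] x]
  have u: "(u has_derivative L) (at x)"
    unfolding u_def[abs_def] L_def[abs_def]
    by (intro has_derivative_diff DF bounded_linear.has_derivative[OF blinfun.bounded_linear_left DDF(1)])
  have ux: "u x = 0"
    using G_app[OF x] by (simp add: u_def h_def)
  have L: "complex_linear L"
    unfolding complex_linear_def L_def
    by (simp add: complex_linearD[OF DF(2)] complex_linearD[OF DDF(2)] blinfun.add_left blinfun.add_right scaleC.diff_right)
  have blL: "bounded_linear L" by (rule has_derivative_bounded_linear[OF u])
  obtain K where K: "\<And>v. norm (L v) \<le> norm v * K"
    using bounded_linear.bounded[OF blL] by blast
  have inb: "\<forall>\<^sub>F y in at x. y \<in> ball 0 1"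
    using x by (intro eventually_at_in_open') auto
  have "(h has_derivative (\<lambda>v. blinfun_apply (G x) (L v))) (at x)"
  proof (rule has_derivativeI)
    show "bounded_linear (\<lambda>v. blinfun_apply (G x) (L v))"
      by (rule bounded_linear_compose[OF blinfun.bounded_linear_right blL])
    let ?R = "\<lambda>y. ((h y - h x) - blinfun_apply (G x) (L (y - x))) /\<^sub>R norm (y - x)"
    let ?Q = "\<lambda>y. ((u y - u x) - L (y - x)) /\<^sub>R norm (y - x)"
    show "(?R \<longlongrightarrow> 0) (at x)"
    proof (rule Lim_null_comparison)
      show "\<forall>\<^sub>F y in at x. norm (?R y) \<le> norm (G y) * norm (?Q y) + norm (G y - G x) * K"
        using inb eventually_neq_at_within[of x x UNIV]
      proof eventually_elim
        case (elim y)
        have "h y - h x = blinfun_apply (G y) (u y)"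
          using G_app[OF elim(1)] by (simp add: h_def u_def blinfun.diff_right)
        then have "?R y = blinfun_apply (G y) (?Q y) + blinfun_apply (G y - G x) (L (y - x)) /\<^sub>R norm (y - x)"
          by (simp add: ux blinfun.bilinear_simps algebra_simps)
        also have "norm \<dots> \<le> norm (G y) * norm (?Q y) + norm (G y - G x) * K"
        proof (intro order_trans[OF norm_triangle_ineq] add_mono norm_blinfun)
          have "norm (blinfun_apply (G y - G x) (L (y - x))) \<le> norm (G y - G x) * (norm (y - x) * K)"
            by (intro order_trans[OF norm_blinfun] mult_left_mono K) auto
          then show "norm (blinfun_apply (G y - G x) (L (y - x)) /\<^sub>R norm (y - x)) \<le> norm (G y - G x) * K"
            using elim(2) by (simp add: field_simps)
        qed
        finally show ?case .
      qed
      have Q: "(?Q \<longlongrightarrow> 0) (at x)"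
        using u unfolding has_derivative_at_within by blast
      have "((\<lambda>y. norm (G y) * norm (?Q y) + norm (G y - G x) * K) \<longlongrightarrow>
          norm (G x) * norm (0 :: 'a) + norm (G x - G x) * K) (at x)"
        by (intro tendsto_intros inverse_frechet_tendsto[OF x] Q)
      then show "((\<lambda>y. norm (G y) * norm (?Q y) + norm (G y - G x) * K) \<longlongrightarrow> 0) (at x)" by simp
    qed
  qed
  moreover have "complex_linear (\<lambda>v. blinfun_apply (G x) (L v))"
    using L complex_linear_inverse_frechet[OF x] unfolding complex_linear_def by simp
  ultimately show "\<exists>D. ((\<lambda>x. blinfun_apply (G x) (F x)) has_derivative D) (at x) \<and> complex_linear D"
    unfolding h_def[abs_def] by blast
qed

end

lemma cmod_minus_half_less_iff:
  assumes "\<alpha> > 0"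
  shows "cmod (p - 1 / (2 * of_real \<alpha>)) < 1 / (2 * \<alpha>) \<longleftrightarrow> Re p > \<alpha> * (cmod p)\<^sup>2"
proof -
  have "cmod (p - 1 / (2 * of_real \<alpha>)) < 1 / (2 * \<alpha>) \<longleftrightarrow>
      (cmod (p - of_real (1 / (2 * \<alpha>))))\<^sup>2 < (1 / (2 * \<alpha>))\<^sup>2"
  proof -
    have sq: "a < b \<longleftrightarrow> a\<^sup>2 < b\<^sup>2" if "0 \<le> a" "0 \<le> b" for a b :: real
      using that power2_less_imp_less[of a b] power_strict_mono[of a b 2] by auto
    show ?thesis
      using assms by (subst sq) simp_all
  qed
  also have "(cmod (p - of_real (1 / (2 * \<alpha>))))\<^sup>2 = (cmod p)\<^sup>2 - Re p / \<alpha> + (1 / (2 * \<alpha>))\<^sup>2"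
    unfolding cmod_power2 using assms by (simp add: field_simps power2_eq_square)
  also have "(cmod p)\<^sup>2 - Re p / \<alpha> + (1 / (2 * \<alpha>))\<^sup>2 < (1 / (2 * \<alpha>))\<^sup>2 \<longleftrightarrow> (cmod p)\<^sup>2 < Re p / \<alpha>"
    by auto
  also have "\<dots> \<longleftrightarrow> Re p > \<alpha> * (cmod p)\<^sup>2"
    using assms by (simp add: field_simps)
  finally show ?thesis .
qed

lemma cnj_div_norm_mult: "z \<noteq> 0 \<Longrightarrow> cnj z / of_real (cmod z) * z = of_real (cmod z)"
  by (simp add: field_simps complex_norm_square[symmetric] power2_eq_square flip: of_real_mult)

lemma support_functional_scaleC:
  assumes T: "T \<in> support_functionals x0" and z: "z \<noteq> 0"
  shows "(cnj z / of_real (cmod z)) *\<^sub>C T \<in> support_functionals (z *\<^sub>C x0)"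
proof -
  have T': "complex_linear (blinfun_apply T)" "norm T = 1" "blinfun_apply T x0 = of_real (norm x0)"
    using T by (auto simp: support_functionals_def)
  have "complex_linear (blinfun_apply ((cnj z / of_real (cmod z)) *\<^sub>C T))"
    using T'(1) by (simp add: complex_linear_def scaleC_complex_def algebra_simps)
  moreover have "norm ((cnj z / of_real (cmod z)) *\<^sub>C T) = 1"
    using T'(2) z by (simp add: norm_scaleC norm_divide)
  ultimately show ?thesis
    using cnj_div_norm_mult[OF z] complex_linearD(2)[OF T'(1), of z x0] T'(3)
    by (simp add: support_functionals_def scaleC_complex_def norm_scaleC mult.assoc[symmetric])
qed

theorem hankel_upper_bound:
  fixes F :: "'a::complex_banach \<Rightarrow> 'a"
  assumes \<alpha>: "0 \<le> \<alpha>" "\<alpha> < 1" and F: "F \<in> starlike_order \<alpha>" and H: "scalar_type_terms F"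
    and x0: "norm x0 = 1" and T: "T \<in> support_functionals x0"
  shows "cmod (A2 F x0 T * A4 F x0 T - (A3 F x0 T)\<^sup>2) \<le> (1 - \<alpha>)\<^sup>2"
proof -
  have Tlin: "complex_linear (blinfun_apply T)" and normT: "norm T = 1" and Tx0: "blinfun_apply T x0 = 1"
    using T x0 by (auto simp: support_functionals_def)
  have F0: "F 0 = 0" "frechet F 0 = id_blinfun" and lb: "locally_biholomorphic F"
    using F by (auto simp: starlike_order_def normalized_def)
  have hol: "complex_differentiable_on F (ball 0 1)"
    using lb by (simp add: locally_biholomorphic_def holomorphic_ball_def complex_differentiable_on_def)
  have "\<forall>x\<in>ball 0 1. \<exists>G. G o\<^sub>L frechet F x = id_blinfun \<and> frechet F x o\<^sub>L G = id_blinfun"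
    using lb by (simp add: locally_biholomorphic_def)
  then obtain G where G: "\<And>x. x \<in> ball 0 1 \<Longrightarrow> G x o\<^sub>L frechet F x = id_blinfun"
      "\<And>x. x \<in> ball 0 1 \<Longrightarrow> frechet F x o\<^sub>L G x = id_blinfun"
    by metis
  have inb: "z *\<^sub>C x0 \<in> ball 0 1 \<longleftrightarrow> z \<in> ball 0 1" for z
    by (simp add: norm_scaleC x0)
  define t where "t z = blinfun_apply T (blinfun_apply (G (z *\<^sub>C x0)) (F (z *\<^sub>C x0)))" for z
  have t_eq: "t z = blinfun_apply T (inv_deriv_apply F (z *\<^sub>C x0))" if "z \<in> ball 0 1" for z
  proof -
    have x: "z *\<^sub>C x0 \<in> ball 0 1" using that by (simp only: inb)
    show ?thesis by (simp add: t_def inv_deriv_apply_eq[OF G(1)[OF x] G(2)[OF x]])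
  qed
  have holt: "t holomorphic_on ball 0 1"
  proof (rule holomorphic_onI)
    fix z :: complex assume z: "z \<in> ball 0 1"
    have "((\<lambda>z. blinfun_apply (G (0 + z *\<^sub>C x0)) (F (0 + z *\<^sub>C x0))) has_derivative
      (\<lambda>w. w *\<^sub>C blinfun_apply (frechet (\<lambda>x. blinfun_apply (G x) (F x)) (0 + z *\<^sub>C x0)) x0)) (at z)"
      by (rule has_derivative_slice[OF complex_differentiable_on_inverse_apply[OF hol G]]) (use z inb in simp_all)
    from has_field_derivative_functional[OF this Tlin]
    show "t field_differentiable (at z within ball 0 1)"
      unfolding t_def[abs_def] by (auto simp: field_differentiable_def intro: DERIV_subset)
  qed
  have t0: "t 0 = 0" by (simp add: t_def F0)
  obtain p where p: "p holomorphic_on ball 0 1" "\<And>z. norm z < 1 \<Longrightarrow> t z = z * p z"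
    using Schwarz3[OF holt t0] by blast
  define a2 where "a2 = A2 F x0 T"
  define a3 where "a3 = A3 F x0 T"
  define a4 where "a4 = A4 F x0 T"
  obtain H where H: "(1 / fact 2) *\<^sub>R frechet_diag2 F 0 x0 = H (1::nat) x0 *\<^sub>C x0"
    "(1 / fact 3) *\<^sub>R frechet_diag3 F 0 x0 = H 2 x0 *\<^sub>C x0"
    "(1 / fact 4) *\<^sub>R frechet_diag4 F 0 x0 = H 3 x0 *\<^sub>C x0"
    using H unfolding scalar_type_terms_def by blast
  have scal: "y = (of_real c * (1 / of_real c * blinfun_apply T y)) *\<^sub>C x0"
    if "(1 / c) *\<^sub>R y = h *\<^sub>C x0" "c \<noteq> 0" for c :: real and y h
  proof -
    have "y = c *\<^sub>R ((1 / c) *\<^sub>R y)" using that(2) by simp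
    also have "\<dots> = (of_real c * h) *\<^sub>C x0"
      unfolding that(1) by (simp add: scaleR_scaleC scaleC_scaleC)
    finally have y: "y = (of_real c * h) *\<^sub>C x0" .
    then have "blinfun_apply T y = of_real c * h"
      by (simp add: complex_linearD(2)[OF Tlin] Tx0 scaleC_complex_def)
    then show ?thesis using y that(2) by simp
  qed
  have diag: "frechet_diag2 F 0 x0 = (2 * a2) *\<^sub>C x0" "frechet_diag3 F 0 x0 = (6 * a3) *\<^sub>C x0"
    "frechet_diag4 F 0 x0 = (24 * a4) *\<^sub>C x0"
    using scal[OF H(1)] scal[OF H(2)] scal[OF H(3)]
    by (simp_all add: a2_def a3_def a4_def A2_def A3_def A4_def fact_numeral)
  define N where "N z = 1 + a2 * z + a3 * z\<^sup>2 + a4 * z ^ 3" for z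
  define Dn where "Dn z = 1 + 2 * a2 * z + 3 * a3 * z\<^sup>2 + 4 * a4 * z ^ 3" for z
  obtain \<delta> C where \<delta>: "\<delta> > 0"
    and TF: "\<And>z. z \<in> ball 0 \<delta> \<Longrightarrow> norm (F (z *\<^sub>C x0) - (F 0 + z *\<^sub>C blinfun_apply (frechet F 0) x0
      + (z\<^sup>2 / 2) *\<^sub>C frechet_diag2 F 0 x0 + (z ^ 3 / 6) *\<^sub>C frechet_diag3 F 0 x0
      + (z ^ 4 / 24) *\<^sub>C frechet_diag4 F 0 x0)) \<le> C * cmod z ^ 5"
    and TD: "\<And>z. z \<in> ball 0 \<delta> \<Longrightarrow> norm (blinfun_apply (frechet F (z *\<^sub>C x0)) x0
      - (blinfun_apply (frechet F 0) x0 + z *\<^sub>C frechet_diag2 F 0 x0 + (z\<^sup>2 / 2) *\<^sub>C frechet_diag3 F 0 x0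
      + (z ^ 3 / 6) *\<^sub>C frechet_diag4 F 0 x0)) \<le> C * cmod z ^ 4"
    by (rule holomorphic_taylor_slice[OF hol, of x0]) auto
  have TF': "norm (F (z *\<^sub>C x0) - (z * N z) *\<^sub>C x0) \<le> C * cmod z ^ 5" if "z \<in> ball 0 \<delta>" for z
  proof -
    have "F 0 + z *\<^sub>C blinfun_apply (frechet F 0) x0 + (z\<^sup>2 / 2) *\<^sub>C frechet_diag2 F 0 x0
      + (z ^ 3 / 6) *\<^sub>C frechet_diag3 F 0 x0 + (z ^ 4 / 24) *\<^sub>C frechet_diag4 F 0 x0 = (z * N z) *\<^sub>C x0"
      by (simp add: F0 diag scaleC_scaleC N_def flip: scaleC_add_left)
        (simp add: algebra_simps eval_nat_numeral)
    then show ?thesis using TF[OF that] by simp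
  qed
  have TD': "norm (blinfun_apply (frechet F (z *\<^sub>C x0)) x0 - Dn z *\<^sub>C x0) \<le> C * cmod z ^ 4"
    if "z \<in> ball 0 \<delta>" for z
  proof -
    have "blinfun_apply (frechet F 0) x0 + z *\<^sub>C frechet_diag2 F 0 x0 + (z\<^sup>2 / 2) *\<^sub>C frechet_diag3 F 0 x0
      + (z ^ 3 / 6) *\<^sub>C frechet_diag4 F 0 x0 = 1 *\<^sub>C x0 + (z * (2 * a2)) *\<^sub>C x0 + (z\<^sup>2 / 2 * (6 * a3)) *\<^sub>C x0
      + (z ^ 3 / 6 * (24 * a4)) *\<^sub>C x0"
      by (simp add: F0 diag scaleC_scaleC)
    also have "\<dots> = Dn z *\<^sub>C x0"
      unfolding scaleC_add_left[symmetric] by (simp add: Dn_def algebra_simps)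
    finally show ?thesis using TD[OF that] by simp
  qed
  have "\<forall>\<^sub>F x in at 0. norm (G x) < norm (G 0) + 1"
    by (rule order_tendstoD(2)[OF tendsto_norm[OF inverse_frechet_tendsto[OF hol G]]]) auto
  then obtain e where e: "e > 0" "\<And>x. x \<noteq> 0 \<Longrightarrow> norm x < e \<Longrightarrow> norm (G x) < norm (G 0) + 1"
    by (auto simp: eventually_at)
  define M where "M = 1 + 2 * cmod a2 + 3 * cmod a3 + 4 * cmod a4"
  define K where "K = (norm (G 0) + 1) * (2 * M * C)"
  define \<epsilon> where "\<epsilon> = min 1 (min \<delta> e)"
  have E: "cmod (z * (Dn z * p z - N z)) \<le> K * cmod z ^ 5" if z: "cmod z < \<epsilon>" for z
  proof -
    have z': "z \<in> ball 0 1" "z \<in> ball 0 \<delta>" "cmod z \<le> 1" "cmod z < e"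
      using z by (auto simp: \<epsilon>_def)
    let ?x = "z *\<^sub>C x0"
    have x: "?x \<in> ball 0 1" using z' inb by simp
    let ?D = "blinfun_apply (frechet F ?x) x0"
    have Glin: "complex_linear (blinfun_apply (G ?x))"
      using complex_linear_inverse_frechet[OF hol G x] .
    have GD: "blinfun_apply (G ?x) ?D = x0"
      using arg_cong[OF G(1)[OF x], of "\<lambda>A. blinfun_apply A x0"] by simp
    have normG: "norm (G ?x) \<le> norm (G 0) + 1"
      using e(2)[of ?x] z' x0 by (cases "?x = 0") (auto simp: norm_scaleC)
    have pw: "cmod z ^ k \<le> 1" for k
      using z' by (simp add: power_le_one)
    have cDn: "cmod (Dn z) \<le> M"
      unfolding Dn_def M_def
      using pw[of 1] pw[of 2] pw[of 3]
      by (intro order_trans[OF norm_triangle_ineq] add_mono) (auto simp: norm_mult norm_power mult_left_le)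
    have cN: "cmod (N z) \<le> M"
    proof -
      have "cmod (N z) \<le> 1 + cmod a2 + cmod a3 + cmod a4"
        unfolding N_def using pw[of 1] pw[of 2] pw[of 3]
        by (intro order_trans[OF norm_triangle_ineq] add_mono) (auto simp: norm_mult norm_power mult_left_le)
      then show ?thesis unfolding M_def using norm_ge_zero[of a2] norm_ge_zero[of a3] norm_ge_zero[of a4]
        by linarith
    qed
    have M0: "M \<ge> 0" by (simp add: M_def)
    define y where "y = Dn z *\<^sub>C (F ?x - (z * N z) *\<^sub>C x0) - (z * N z) *\<^sub>C (?D - Dn z *\<^sub>C x0)"
    have y: "y = Dn z *\<^sub>C F ?x - (z * N z) *\<^sub>C ?D"
      by (simp add: y_def scaleC.diff_right scaleC_scaleC mult.commute)
    have "norm y \<le> M * (C * cmod z ^ 5) + (cmod z * M) * (C * cmod z ^ 4)"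
      unfolding y_def
    proof (rule order_trans[OF norm_triangle_ineq4 add_mono])
      show "norm (Dn z *\<^sub>C (F ?x - (z * N z) *\<^sub>C x0)) \<le> M * (C * cmod z ^ 5)"
        unfolding norm_scaleC using M0 by (intro mult_mono cDn TF' z') auto
      show "norm ((z * N z) *\<^sub>C (?D - Dn z *\<^sub>C x0)) \<le> (cmod z * M) * (C * cmod z ^ 4)"
        unfolding norm_scaleC norm_mult using M0 by (intro mult_mono cN TD' z' order_refl) auto
    qed
    also have "\<dots> = 2 * M * C * cmod z ^ 5"
      by (simp add: eval_nat_numeral)
    finally have ny: "norm y \<le> 2 * M * C * cmod z ^ 5" .
    have "blinfun_apply T (blinfun_apply (G ?x) y) = Dn z * t z - z * N z"
      by (simp add: y blinfun.diff_right complex_linearD(2)[OF Glin] complex_linearD(2)[OF Tlin] GD Tx0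
          scaleC_complex_def t_def)
    also have "\<dots> = z * (Dn z * p z - N z)"
      using p(2)[of z] z' by (simp add: algebra_simps)
    finally have "cmod (z * (Dn z * p z - N z)) = cmod (blinfun_apply T (blinfun_apply (G ?x) y))"
      by simp
    also have "\<dots> \<le> norm T * (norm (G ?x) * norm y)"
      by (intro order_trans[OF norm_blinfun] mult_left_mono norm_blinfun) auto
    also have "\<dots> \<le> 1 * ((norm (G 0) + 1) * (2 * M * C * cmod z ^ 5))"
      using normT by (intro mult_mono normG ny) auto
    finally show ?thesis by (simp add: K_def mult.assoc)
  qed
  define P where "P = fps_expansion p 0"
  have expp: "p has_fps_expansion P"
    unfolding P_def by (rule holomorphic_has_fps_expansion[OF p(1)]) simp
  define DN where "DN = 1 + fps_const (2 * a2) * fps_X + fps_const (3 * a3) * fps_X\<^sup>2 + fps_const (4 * a4) * fps_X ^ 3"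
  define NN where "NN = 1 + fps_const a2 * fps_X + fps_const a3 * fps_X\<^sup>2 + fps_const a4 * fps_X ^ 3"
  have "(\<lambda>z. z * (Dn z * p z - N z)) has_fps_expansion fps_X * (DN * P - NN)"
    unfolding Dn_def N_def DN_def NN_def by (intro fps_expansion_intros expp)
  then have "fps_nth (fps_X * (DN * P - NN)) (Suc k) = 0" if "k < 4" for k
    using that \<delta> e(1) E by (intro fps_nth_eq_0_of_bound[where n = 5 and \<delta> = \<epsilon> and C = K]) (auto simp: \<epsilon>_def)
  then have coeff: "fps_nth (DN * P) k = fps_nth NN k" if "k < 4" for k
    using that by simp
  have nthD: "fps_nth DN 0 = 1" "fps_nth DN 1 = 2 * a2" "fps_nth DN 2 = 3 * a3" "fps_nth DN 3 = 4 * a4"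
    by (simp_all add: DN_def fps_X_power_nth)
  have nthN: "fps_nth NN 0 = 1" "fps_nth NN 1 = a2" "fps_nth NN 2 = a3" "fps_nth NN 3 = a4"
    by (simp_all add: NN_def fps_X_power_nth)
  have P0: "fps_nth P 0 = 1"
    using coeff[of 0] by (simp add: nthD nthN)
  have c1: "fps_nth P 1 + 2 * a2 = a2"
    using coeff[of 1] nthD nthN P0 by (simp add: fps_mult_nth)
  have c2: "fps_nth P 2 + 2 * a2 * fps_nth P 1 + 3 * a3 = a3"
    using coeff[of 2] nthD nthN P0 by (simp add: fps_mult_nth numeral_2_eq_2)
  have c3: "fps_nth P 3 + 2 * a2 * fps_nth P 2 + 3 * a3 * fps_nth P 1 + 4 * a4 = a4"
    using coeff[of 3] nthD nthN P0 by (simp add: fps_mult_nth numeral_2_eq_2 numeral_3_eq_3)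
  have p0: "p 0 = 1"
    using has_fps_expansion_imp_0_eq_fps_nth_0[OF expp] P0 by simp
  have Re: "Re (p z) > \<alpha> * (cmod (p z))\<^sup>2" if z: "z \<in> ball 0 1" for z
  proof (cases "z = 0")
    case True
    then show ?thesis using p0 \<alpha> by simp
  next
    case False
    let ?S = "(cnj z / of_real (cmod z)) *\<^sub>C T"
    have x: "z *\<^sub>C x0 \<in> ball 0 1 - {0}"
    proof -
      have "norm (z *\<^sub>C x0) \<noteq> 0" using False by (simp add: norm_scaleC x0)
      then show ?thesis using z inb by auto
    qed
    have "blinfun_apply ?S (inv_deriv_apply F (z *\<^sub>C x0)) = cnj z / of_real (cmod z) * (z * p z)"
      using p(2)[of z] z by (simp add: scaleC_complex_def flip: t_eq)
    also have "\<dots> = of_real (cmod z) * p z"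
      unfolding mult.assoc[symmetric] cnj_div_norm_mult[OF False] ..
    finally have S: "blinfun_apply ?S (inv_deriv_apply F (z *\<^sub>C x0)) = of_real (cmod z) * p z" .
    have cond: "if \<alpha> = 0 then Re (blinfun_apply ?S (inv_deriv_apply F (z *\<^sub>C x0))) > 0
          else cmod (1 / of_real (norm (z *\<^sub>C x0)) * blinfun_apply ?S (inv_deriv_apply F (z *\<^sub>C x0))
                      - 1 / (2 * of_real \<alpha>)) < 1 / (2 * \<alpha>)"
      using F x support_functional_scaleC[OF T False] unfolding starlike_order_def by blast
    show ?thesis
    proof (cases "\<alpha> = 0")
      case True
      then show ?thesis using cond False unfolding S by (simp add: zero_less_mult_iff)
    next
      case a: False
      then show ?thesis
        using cond False \<alpha> unfolding S by (simp add: norm_scaleC x0 cmod_minus_half_less_iff)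
    qed
  qed
  have "cmod (a2 * a4 - a3\<^sup>2) \<le> (1 - \<alpha>)\<^sup>2"
  proof (rule starlike_hankel_bound[OF p(1) p0 \<alpha> Re], unfold P_def[symmetric])
    show "fps_nth P 1 + a2 = 0"
      using arg_cong[OF c1, of "\<lambda>y. y - a2"] by (simp add: add_diff_eq[symmetric] del: One_nat_def)
    show "fps_nth P 2 + 2 * a2 * fps_nth P 1 + 2 * a3 = 0"
      using arg_cong[OF c2, of "\<lambda>y. y - a3"] by (simp add: add_diff_eq[symmetric] del: One_nat_def)
    show "fps_nth P 3 + 2 * a2 * fps_nth P 2 + 3 * a3 * fps_nth P 1 + 3 * a4 = 0"
      using arg_cong[OF c3, of "\<lambda>y. y - a4"] by (simp add: add_diff_eq[symmetric] del: One_nat_def)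
  qed
  then show ?thesis by (simp add: a2_def a3_def a4_def)
qed

section \<open>Sharpness\<close>

context
  fixes l :: "'a::complex_banach \<Rightarrow>\<^sub>L complex" and g :: "complex \<Rightarrow> complex"
  assumes l: "complex_linear (blinfun_apply l)" "norm l \<le> 1"
    and g: "g holomorphic_on ball 0 1"
    and g_nz: "\<And>w. w \<in> ball 0 1 \<Longrightarrow> g w \<noteq> 0"
    and q_nz: "\<And>w. w \<in> ball 0 1 \<Longrightarrow> g w + w * deriv g w \<noteq> 0"
begin

private abbreviation F :: "'a \<Rightarrow> 'a" where "F x \<equiv> g (blinfun_apply l x) *\<^sub>C x"

private lemma l_ball: "x \<in> ball 0 1 \<Longrightarrow> blinfun_apply l x \<in> ball 0 1"
  using norm_blinfun[of l x] l(2) mult_right_mono[of "norm l" 1 "norm x"] by simp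

private lemma l_scaleC [simp]: "blinfun_apply l (c *\<^sub>C x) = c * blinfun_apply l x"
  using complex_linearD(2)[OF l(1)] by (simp add: scaleC_complex_def)

lemma scalar_multiple_has_derivative:
  assumes x: "x \<in> ball 0 1"
  shows "(F has_derivative (\<lambda>v. g (blinfun_apply l x) *\<^sub>C v
    + (deriv g (blinfun_apply l x) * blinfun_apply l v) *\<^sub>C x)) (at x)"
proof -
  have "(g has_field_derivative deriv g (blinfun_apply l x)) (at (blinfun_apply l x))"
    using l_ball[OF x] g by (intro holomorphic_derivI) auto
  then have "((\<lambda>y. g (blinfun_apply l y)) has_derivative
      (\<lambda>v. deriv g (blinfun_apply l x) * blinfun_apply l v)) (at x)"
    unfolding has_field_derivative_def
    by (rule has_derivative_compose[OF bounded_linear_imp_has_derivative[OF blinfun.bounded_linear_right]])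
  from scaleC.FDERIV[OF this has_derivative_ident] show ?thesis .
qed

lemma scalar_multiple_complex_linear:
  "complex_linear (\<lambda>v. g (blinfun_apply l x) *\<^sub>C v + (deriv g (blinfun_apply l x) * blinfun_apply l v) *\<^sub>C x)"
  by (simp add: complex_linear_def blinfun.add_right scaleC_add_left scaleC_add_right scaleC_scaleC algebra_simps)

lemma scalar_multiple_complex_differentiable: "complex_differentiable_on F (ball 0 1)"
  unfolding complex_differentiable_on_def
  using scalar_multiple_has_derivative scalar_multiple_complex_linear by blast

lemma scalar_multiple_inverse:
  assumes x: "x \<in> ball 0 1"
  defines "w \<equiv> blinfun_apply l x"
  shows "\<exists>G. G o\<^sub>L frechet F x = id_blinfun \<and> frechet F x o\<^sub>L G = id_blinfun \<and>
    blinfun_apply G (F x) = (g w / (g w + w * deriv g w)) *\<^sub>C x"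
proof -
  define q where "q = g w + w * deriv g w"
  have nz: "g w \<noteq> 0" "q \<noteq> 0"
    using g_nz q_nz l_ball[OF x] by (auto simp: w_def q_def)
  have D: "blinfun_apply (frechet F x) v = g w *\<^sub>C v + (deriv g w * blinfun_apply l v) *\<^sub>C x" for v
    unfolding blinfun_apply_frechet[OF scalar_multiple_has_derivative[OF x]] w_def ..
  define G where "G v = (1 / g w) *\<^sub>C (v - (deriv g w / q * blinfun_apply l v) *\<^sub>C x)" for v
  have "bounded_linear G"
    unfolding G_def[abs_def]
    by (intro bounded_linear_compose[OF scaleC.bounded_linear_right] bounded_linear_sub bounded_linear_ident
        bounded_linear_compose[OF scaleC.bounded_linear_left]
        bounded_linear_compose[OF bounded_linear_mult_right] blinfun.bounded_linear_right)
  then have app: "blinfun_apply (Blinfun G) = G"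
    by (rule bounded_linear_Blinfun_apply)
  have lD: "blinfun_apply l (g w *\<^sub>C v + (deriv g w * blinfun_apply l v) *\<^sub>C x) = q * blinfun_apply l v" for v
    by (simp add: blinfun.add_right q_def w_def[symmetric] algebra_simps)
  have lG: "blinfun_apply l (G v) = blinfun_apply l v / q" for v
  proof -
    have "blinfun_apply l (G v) = (1 / g w) * (blinfun_apply l v - deriv g w / q * blinfun_apply l v * w)"
      by (simp add: G_def blinfun.diff_right w_def)
    also have "\<dots> = (1 / g w) * (blinfun_apply l v * (q - w * deriv g w) / q)"
      using nz by (simp add: field_simps)
    also have "\<dots> = blinfun_apply l v / q"
      using nz by (simp add: q_def)
    finally show ?thesis .
  qed
  have 1: "Blinfun G o\<^sub>L frechet F x = id_blinfun"
  proof (rule blinfun_eqI)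
    fix v
    show "blinfun_apply (Blinfun G o\<^sub>L frechet F x) v = blinfun_apply id_blinfun v"
      using nz by (simp add: app D G_def lD scaleC_scaleC)
  qed
  have 2: "frechet F x o\<^sub>L Blinfun G = id_blinfun"
  proof (rule blinfun_eqI)
    fix v
    have "g w *\<^sub>C G v = v - (deriv g w / q * blinfun_apply l v) *\<^sub>C x"
      using nz by (simp add: G_def scaleC_scaleC)
    then show "blinfun_apply (frechet F x o\<^sub>L Blinfun G) v = blinfun_apply id_blinfun v"
      by (simp add: app D lG)
  qed
  have "G (F x) = (1 / g w * (g w - deriv g w / q * (g w * w))) *\<^sub>C x"
    by (simp add: G_def w_def[symmetric] scaleC_scaleC scaleC.diff_right scaleC.diff_left right_diff_distrib)
  also have "1 / g w * (g w - deriv g w / q * (g w * w)) = g w / q"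
    using nz by (simp add: field_simps) (simp add: q_def algebra_simps)
  finally have "blinfun_apply (Blinfun G) (F x) = (g w / (g w + w * deriv g w)) *\<^sub>C x"
    by (simp add: app q_def)
  with 1 2 show ?thesis by blast
qed

lemma scalar_multiple_locally_biholomorphic: "locally_biholomorphic F"
  unfolding locally_biholomorphic_def holomorphic_ball_def
  using scalar_multiple_complex_differentiable scalar_multiple_inverse
  unfolding complex_differentiable_on_def by blast

lemma scalar_multiple_inv_deriv_apply:
  assumes "x \<in> ball 0 1"
  shows "inv_deriv_apply F x = (g (blinfun_apply l x)
    / (g (blinfun_apply l x) + blinfun_apply l x * deriv g (blinfun_apply l x))) *\<^sub>C x"
  using scalar_multiple_inverse[OF assms] inv_deriv_apply_eq by metis

lemma scalar_multiple_normalized: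
  assumes "g 0 = 1"
  shows "normalized F"
proof -
  have "blinfun_apply (frechet F 0) v = v" for v
    using blinfun_apply_frechet[OF scalar_multiple_has_derivative[of 0]] assms by simp
  then show ?thesis
    by (auto simp: normalized_def intro!: blinfun_eqI)
qed

text \<open>Along the line through \<open>x\<close> the map is \<open>z \<mapsto> m(z) x\<close> with the scalar function
  \<open>m(z) = z g(z l(x))\<close>, whose derivatives at the origin are the iterated Frechet derivatives.\<close>

lemma scalar_multiple_diag:
  fixes x :: 'a
  defines "m \<equiv> \<lambda>z. z * g (z * blinfun_apply l x)"
  shows "frechet_diag2 F 0 x = (deriv ^^ 2) m 0 *\<^sub>C x"
    "frechet_diag3 F 0 x = (deriv ^^ 3) m 0 *\<^sub>C x"
    "frechet_diag4 F 0 x = (deriv ^^ 4) m 0 *\<^sub>C x"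
proof -
  define U where "U = (\<lambda>z. z *\<^sub>C x) -` ball 0 1"
  have U: "open U" "0 \<in> U"
    unfolding U_def by (intro open_vimage open_ball)
      (simp_all add: bounded_linear.continuous_on[OF scaleC.bounded_linear_left] continuous_on_id)
  have "(g \<circ> (\<lambda>z. z * blinfun_apply l x)) holomorphic_on U"
  proof (rule holomorphic_on_compose_gen[OF _ g])
    show "(\<lambda>z. z * blinfun_apply l x) ` U \<subseteq> ball 0 1"
    proof
      fix w assume "w \<in> (\<lambda>z. z * blinfun_apply l x) ` U"
      then obtain z where "z *\<^sub>C x \<in> ball 0 1" "w = blinfun_apply l (z *\<^sub>C x)"
        by (auto simp: U_def)
      then show "w \<in> ball 0 1" using l_ball by blast
    qed
  qed (intro holomorphic_intros)
  then have "m holomorphic_on U"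
    unfolding m_def o_def by (intro holomorphic_on_mult holomorphic_on_ident)
  then have hol: "(deriv ^^ k) m holomorphic_on U" for k
    by (rule holomorphic_higher_deriv[OF _ U(1)])
  have step: "f' z = (deriv ^^ Suc k) m z *\<^sub>C x"
    if f: "\<And>z. z \<in> U \<Longrightarrow> f z = (deriv ^^ k) m z *\<^sub>C x"
      and der: "(f has_derivative (\<lambda>w. w *\<^sub>C f' z)) (at z)" and z: "z \<in> U" for f f' k z
  proof -
    have "((deriv ^^ k) m has_field_derivative (deriv ^^ Suc k) m z) (at z)"
      using holomorphic_derivI[OF hol U(1) z] by simp
    then have "((deriv ^^ k) m has_derivative (\<lambda>w. w * (deriv ^^ Suc k) m z)) (at z)"
      unfolding has_field_derivative_def by (rule has_derivative_eq_rhs) (simp add: fun_eq_iff mult.commute)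
    from bounded_linear.has_derivative[OF scaleC.bounded_linear_left this, of x]
    have "((\<lambda>z. (deriv ^^ k) m z *\<^sub>C x) has_derivative (\<lambda>w. (w * (deriv ^^ Suc k) m z) *\<^sub>C x)) (at z)" .
    then have "(f has_derivative (\<lambda>w. (w * (deriv ^^ Suc k) m z) *\<^sub>C x)) (at z)"
      by (rule has_derivative_transform_within_open[OF _ U(1) z]) (simp add: f)
    from has_derivative_unique[OF der this] show ?thesis
      by (auto dest: fun_cong[of _ _ 1])
  qed
  note S = iterated_frechet_slices[OF scalar_multiple_complex_differentiable open_ball]
  have inb: "z *\<^sub>C x \<in> ball 0 1" if "z \<in> U" for z
    using that by (simp add: U_def)
  have f0: "F (z *\<^sub>C x) = (deriv ^^ 0) m z *\<^sub>C x" for z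
    by (simp add: m_def scaleC_scaleC mult.commute)
  have f1: "blinfun_apply (frechet F (z *\<^sub>C x)) x = (deriv ^^ 1) m z *\<^sub>C x" if "z \<in> U" for z
    using step[of "\<lambda>z. F (z *\<^sub>C x)" 0 "\<lambda>z. blinfun_apply (frechet F (z *\<^sub>C x)) x", OF f0 S(1)[OF inb[OF that]] that] by simp
  have f2: "frechet_diag2 F (z *\<^sub>C x) x = (deriv ^^ 2) m z *\<^sub>C x" if "z \<in> U" for z
    using step[of "\<lambda>z. blinfun_apply (frechet F (z *\<^sub>C x)) x" 1 "\<lambda>z. frechet_diag2 F (z *\<^sub>C x) x", OF f1 S(2)[OF inb[OF that]] that] by (simp add: numeral_2_eq_2)
  have f3: "frechet_diag3 F (z *\<^sub>C x) x = (deriv ^^ 3) m z *\<^sub>C x" if "z \<in> U" for z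
    using step[of "\<lambda>z. frechet_diag2 F (z *\<^sub>C x) x" 2 "\<lambda>z. frechet_diag3 F (z *\<^sub>C x) x", OF f2 S(3)[OF inb[OF that]] that] by (simp add: numeral_3_eq_3)
  have f4: "frechet_diag4 F (z *\<^sub>C x) x = (deriv ^^ 4) m z *\<^sub>C x" if "z \<in> U" for z
    using step[of "\<lambda>z. frechet_diag3 F (z *\<^sub>C x) x" 3 "\<lambda>z. frechet_diag4 F (z *\<^sub>C x) x", OF f3 S(4)[OF inb[OF that]] that] by (simp add: eval_nat_numeral)
  show "frechet_diag2 F 0 x = (deriv ^^ 2) m 0 *\<^sub>C x"
    "frechet_diag3 F 0 x = (deriv ^^ 3) m 0 *\<^sub>C x"
    "frechet_diag4 F 0 x = (deriv ^^ 4) m 0 *\<^sub>C x"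
    using f2[OF U(2)] f3[OF U(2)] f4[OF U(2)] by simp_all
qed

end

text \<open>The map \<open>w \<mapsto> w (1 - w\<^sup>2)\<^sup>-\<^sup>\<beta>\<close> is the starlike function of order \<open>1 - \<beta>\<close> whose Schwarz
  function is \<open>w\<^sup>2\<close>.\<close>

definition koebe_quotient :: "real \<Rightarrow> complex \<Rightarrow> complex"
  where "koebe_quotient \<beta> w = exp (- of_real \<beta> * Ln (1 - w\<^sup>2))"

lemma one_minus_square:
  assumes "w \<in> ball (0::complex) 1"
  shows "1 - w\<^sup>2 \<notin> \<real>\<^sub>\<le>\<^sub>0" "1 - w\<^sup>2 \<noteq> 0" "cmod (w\<^sup>2) < 1"
proof -
  show lt: "cmod (w\<^sup>2) < 1"
    using assms by (simp add: norm_power power_less_one_iff abs_square_less_1)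
  then have "Re (1 - w\<^sup>2) > 0"
    using complex_Re_le_cmod[of "w\<^sup>2"] by simp
  then show "1 - w\<^sup>2 \<notin> \<real>\<^sub>\<le>\<^sub>0" "1 - w\<^sup>2 \<noteq> 0"
    by (auto simp: complex_nonpos_Reals_iff)
qed

lemma koebe_quotient_has_derivative:
  assumes w: "w \<in> ball (0::complex) 1"
  shows "(koebe_quotient \<beta> has_field_derivative
    koebe_quotient \<beta> w * (2 * of_real \<beta> * w / (1 - w\<^sup>2))) (at w)"
  unfolding koebe_quotient_def[abs_def]
  using one_minus_square[OF w] by (auto intro!: derivative_eq_intros simp: field_simps)

lemma koebe_quotient_holomorphic: "koebe_quotient \<beta> holomorphic_on ball 0 1"
  using koebe_quotient_has_derivative by (meson at_within_open holomorphic_on_open open_ball)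

lemma koebe_quotient_nonzero: "koebe_quotient \<beta> w \<noteq> 0"
  by (simp add: koebe_quotient_def)

lemma koebe_quotient_0: "koebe_quotient \<beta> 0 = 1"
  by (simp add: koebe_quotient_def)

lemma koebe_quotient_starlike:
  assumes w: "w \<in> ball (0::complex) 1" and \<beta>: "0 < \<beta>" "\<beta> \<le> 1"
  defines "g \<equiv> koebe_quotient \<beta>"
  defines "p \<equiv> g w / (g w + w * deriv g w)"
  shows "g w + w * deriv g w \<noteq> 0" "Re p > (1 - \<beta>) * (cmod p)\<^sup>2"
proof -
  define v where "v = w\<^sup>2"
  define M where "M = 1 - of_real (1 - 2 * \<beta>) * v"
  have v: "cmod v < 1" "1 - v \<noteq> 0"
    using one_minus_square[OF w] by (auto simp: v_def)
  have gw: "g w \<noteq> 0" by (simp add: g_def koebe_quotient_nonzero)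
  have "deriv g w = g w * (2 * of_real \<beta> * w / (1 - v))"
    unfolding g_def v_def by (rule DERIV_imp_deriv[OF koebe_quotient_has_derivative[OF w]])
  then have "g w + w * deriv g w = g w * (1 + 2 * of_real \<beta> * v / (1 - v))"
    by (simp add: v_def power2_eq_square algebra_simps)
  also have "1 + 2 * of_real \<beta> * v / (1 - v) = M / (1 - v)"
    using v by (simp add: M_def field_simps)
  finally have q: "g w + w * deriv g w = g w * (M / (1 - v))" .
  have M: "M \<noteq> 0"
  proof
    assume "M = 0"
    then have "cmod (of_real (1 - 2 * \<beta>) * v) = 1"
      unfolding M_def by (metis norm_one right_minus_eq)
    moreover have "cmod (of_real (1 - 2 * \<beta>) * v) \<le> 1 * cmod v"
      unfolding norm_mult norm_of_real using \<beta> by (intro mult_right_mono) auto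
    ultimately show False using v by simp
  qed
  then show "g w + w * deriv g w \<noteq> 0"
    using gw v q by simp
  have p: "p = (1 - v) / M"
    unfolding p_def q using gw v M by (simp add: field_simps)
  have pos: "0 < (cmod M)\<^sup>2" using M by simp
  have "Re ((1 - v) * cnj M) - (1 - \<beta>) * (cmod (1 - v))\<^sup>2 = \<beta> * (1 - (cmod v)\<^sup>2)"
    unfolding cmod_power2 M_def by (simp add: algebra_simps power2_eq_square)
  moreover have "0 < \<beta> * (1 - (cmod v)\<^sup>2)"
    using \<beta> v by (intro mult_pos_pos) (auto simp: abs_square_less_1)
  ultimately have "(1 - \<beta>) * (cmod (1 - v))\<^sup>2 < Re ((1 - v) * cnj M)"
    by linarith
  then have "(1 - \<beta>) * (cmod (1 - v))\<^sup>2 / (cmod M)\<^sup>2 < Re ((1 - v) * cnj M) / (cmod M)\<^sup>2"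
    using pos by (intro divide_strict_right_mono)
  moreover have "Re p = Re ((1 - v) * cnj M) / (cmod M)\<^sup>2"
    unfolding p complex_div_cnj[of "1 - v" M] by (simp flip: of_real_power)
  moreover have "(cmod p)\<^sup>2 = (cmod (1 - v))\<^sup>2 / (cmod M)\<^sup>2"
    unfolding p by (simp add: norm_divide power_divide)
  ultimately show "Re p > (1 - \<beta>) * (cmod p)\<^sup>2" by simp
qed

lemma koebe_quotient_derivs:
  fixes c :: complex and \<beta> :: real
  defines "m \<equiv> \<lambda>z. z * koebe_quotient \<beta> (z * c)"
  shows "(deriv ^^ 2) m 0 = 0" "(deriv ^^ 3) m 0 = 6 * (of_real \<beta> * c\<^sup>2)" "(deriv ^^ 4) m 0 = 0"
proof -
  define r where "r = 1 / (cmod c + 1)"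
  have n: "cmod c + 1 > 0" using norm_ge_zero[of c] by linarith
  have r: "r > 0" using n by (simp add: r_def)
  have zc: "z * c \<in> ball 0 1" if "z \<in> ball 0 r" for z
  proof -
    have "cmod z * cmod c + cmod z < 1"
      using that n by (simp add: r_def field_simps)
    then have "cmod z * cmod c < 1"
      using norm_ge_zero[of z] by linarith
    then show ?thesis by (simp add: norm_mult)
  qed
  define k where "k z = koebe_quotient \<beta> (z * c)" for z
  have der: "(k has_field_derivative k z * (2 * of_real \<beta> * (z * c) / (1 - (z * c)\<^sup>2)) * c) (at z)"
    if "z \<in> ball 0 r" for z
    unfolding k_def
    by (rule DERIV_chain2[of "koebe_quotient \<beta>" _ "\<lambda>z. z * c", OF koebe_quotient_has_derivative[OF zc[OF that]]])
      (auto intro!: derivative_eq_intros)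
  have hol: "k holomorphic_on ball 0 r"
    using der by (meson at_within_open holomorphic_on_open open_ball)
  define Q where "Q = fps_expansion k 0"
  have expk: "k has_fps_expansion Q"
    unfolding Q_def by (rule holomorphic_has_fps_expansion[OF hol r])
  have "(\<lambda>z. (1 - c\<^sup>2 * z\<^sup>2) * deriv k z) has_fps_expansion (1 - fps_const (c\<^sup>2) * fps_X\<^sup>2) * fps_deriv Q"
    by (intro fps_expansion_intros expk)
  moreover have "(\<lambda>z. 2 * of_real \<beta> * c\<^sup>2 * (z * k z)) has_fps_expansion fps_const (2 * of_real \<beta> * c\<^sup>2) * (fps_X * Q)"
    by (intro fps_expansion_intros expk)
  ultimately have ode: "(1 - fps_const (c\<^sup>2) * fps_X\<^sup>2) * fps_deriv Q = fps_const (2 * of_real \<beta> * c\<^sup>2) * (fps_X * Q)"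
  proof (rule fps_expansion_eq_on_ball[OF _ _ r])
    fix z :: complex assume z: "z \<in> ball 0 r"
    have "1 - (z * c)\<^sup>2 \<noteq> 0" using one_minus_square(2)[OF zc[OF z]] .
    then show "(1 - c\<^sup>2 * z\<^sup>2) * deriv k z = 2 * of_real \<beta> * c\<^sup>2 * (z * k z)"
      using DERIV_imp_deriv[OF der[OF z]] by (simp add: power_mult_distrib field_simps power2_eq_square)
  qed
  have Q0: "fps_nth Q 0 = 1"
    using has_fps_expansion_imp_0_eq_fps_nth_0[OF expk] by (simp add: k_def koebe_quotient_0)
  have nth: "fps_nth (fps_deriv Q) n - c\<^sup>2 * (if n < 2 then 0 else fps_nth (fps_deriv Q) (n - 2))
      = 2 * of_real \<beta> * c\<^sup>2 * (if n = 0 then 0 else fps_nth Q (n - 1))" for n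
    using arg_cong[OF ode, of "\<lambda>A. fps_nth A n"]
    by (simp add: left_diff_distrib mult.assoc fps_X_power_mult_nth)
  have Q1: "fps_nth Q 1 = 0" using nth[of 0] by simp
  have Q2: "fps_nth Q 2 = of_real \<beta> * c\<^sup>2" using nth[of 1] Q0 by (simp add: numeral_2_eq_2)
  have Q3: "fps_nth Q 3 = 0" using nth[of 2] Q1 by (simp add: numeral_3_eq_3 numeral_2_eq_2)
  have "m has_fps_expansion fps_X * Q"
    unfolding m_def k_def[symmetric] by (intro fps_expansion_intros expk)
  then have "fps_nth (fps_X * Q) n = (deriv ^^ n) m 0 / fact n" for n
    by (rule fps_nth_fps_expansion)
  from this[of 2] this[of 3] this[of 4]
  show "(deriv ^^ 2) m 0 = 0" "(deriv ^^ 3) m 0 = 6 * (of_real \<beta> * c\<^sup>2)" "(deriv ^^ 4) m 0 = 0"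
    using Q1 Q2 Q3 by (auto simp: fact_numeral field_simps)
qed

lemma homogeneous_polynomial_zero: "homogeneous_polynomial k (\<lambda>_. 0)"
  unfolding homogeneous_polynomial_def bounded_multilinear_def
  by (intro exI[of _ "\<lambda>_. 0"]) (auto simp: complex_linear_def intro!: exI[of _ 0])

lemma homogeneous_polynomial_functional_square:
  assumes l: "complex_linear (blinfun_apply l)"
  shows "homogeneous_polynomial 2 (\<lambda>x. c * (blinfun_apply l x)\<^sup>2)"
  unfolding homogeneous_polynomial_def
proof (intro exI conjI allI)
  let ?L = "\<lambda>xs. c * (blinfun_apply l (xs ! 0) * blinfun_apply l (xs ! 1))"
  show "bounded_multilinear 2 ?L"
    unfolding bounded_multilinear_def
  proof (intro conjI allI impI)
    fix xs :: "'a list" and i :: nat assume "length xs = 2 \<and> i < 2"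
    then obtain a b where "xs = [a, b]" "i = 0 \<or> i = 1"
      by (auto simp: numeral_2_eq_2 length_Suc_conv less_Suc_eq)
    then show "complex_linear (\<lambda>y. ?L (xs[i := y]))"
      using complex_linearD(1,2)[OF l] by (auto simp: complex_linear_def scaleC_complex_def algebra_simps)
  next
    show "\<exists>C. \<forall>xs. length xs = 2 \<longrightarrow> cmod (?L xs) \<le> C * prod_list (map norm xs)"
    proof (intro exI allI impI)
      fix xs :: "'a list" assume "length xs = 2"
      then obtain a b where xs: "xs = [a, b]"
        by (auto simp: numeral_2_eq_2 length_Suc_conv)
      have "cmod (?L xs) \<le> cmod c * ((norm l * norm a) * (norm l * norm b))"
        unfolding xs norm_mult by (intro mult_left_mono mult_mono) (auto intro: norm_blinfun)
      then show "cmod (?L xs) \<le> cmod c * (norm l)\<^sup>2 * prod_list (map norm xs)"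
        by (simp add: xs power2_eq_square mult_ac)
    qed
  qed
qed (simp add: numeral_2_eq_2)

theorem hankel_bound_attained:
  assumes X: "\<exists>x :: 'a::complex_banach. x \<noteq> 0" and \<alpha>: "0 \<le> \<alpha>" "\<alpha> < 1"
  shows "\<exists>F :: 'a \<Rightarrow> 'a. locally_biholomorphic F \<and> scalar_type_terms F \<and> F \<in> starlike_order \<alpha> \<and>
    (\<exists>x0 T. norm x0 = 1 \<and> T \<in> support_functionals x0 \<and>
      cmod (A2 F x0 T * A4 F x0 T - (A3 F x0 T)\<^sup>2) = (1 - \<alpha>)\<^sup>2)"
proof -
  obtain x1 :: 'a where "x1 \<noteq> 0" using X by blast
  define u where "u = x1 /\<^sub>R norm x1"
  have u: "norm u = 1" using \<open>x1 \<noteq> 0\<close> by (simp add: u_def)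
  then have "u \<noteq> 0" by auto
  then obtain l where lu: "l \<in> support_functionals u"
    by (rule ex_support_functional)
  then have l: "complex_linear (blinfun_apply l)" "norm l = 1" "blinfun_apply l u = 1"
    using u by (auto simp: support_functionals_def)
  define \<beta> where "\<beta> = 1 - \<alpha>"
  have \<beta>: "0 < \<beta>" "\<beta> \<le> 1" using \<alpha> by (auto simp: \<beta>_def)
  define F where "F x = koebe_quotient \<beta> (blinfun_apply l x) *\<^sub>C x" for x
  note ctx = l(1) order_eq_refl[OF l(2)] koebe_quotient_holomorphic koebe_quotient_nonzero
    koebe_quotient_starlike(1)[OF _ \<beta>]
  have lb: "locally_biholomorphic F"
    unfolding F_def[abs_def] by (rule scalar_multiple_locally_biholomorphic[OF ctx])
  have norm: "normalized F"
    unfolding F_def[abs_def] by (rule scalar_multiple_normalized[OF ctx koebe_quotient_0])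
  have diag: "frechet_diag2 F 0 x = 0" "frechet_diag3 F 0 x = (6 * (of_real \<beta> * (blinfun_apply l x)\<^sup>2)) *\<^sub>C x"
    "frechet_diag4 F 0 x = 0" for x
    unfolding F_def[abs_def] by (simp_all only: scalar_multiple_diag[OF ctx] koebe_quotient_derivs) simp_all
  have "scalar_type_terms F"
    unfolding scalar_type_terms_def
  proof (intro exI conjI)
    let ?H = "\<lambda>k x. if k = (2::nat) then of_real \<beta> * (blinfun_apply l x)\<^sup>2 else 0"
    show "\<forall>k\<in>{1, 2, 3}. homogeneous_polynomial k (?H k)"
      by (simp add: homogeneous_polynomial_zero homogeneous_polynomial_functional_square[OF l(1)])
  qed (simp_all add: diag fact_numeral scaleR_scaleC scaleC_scaleC)
  moreover have "F \<in> starlike_order \<alpha>"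
    unfolding starlike_order_def
  proof (intro CollectI conjI norm lb ballI)
    fix x :: 'a and T assume x: "x \<in> ball 0 1 - {0}" and T: "T \<in> support_functionals x"
    let ?w = "blinfun_apply l x"
    define p where "p = koebe_quotient \<beta> ?w / (koebe_quotient \<beta> ?w + ?w * deriv (koebe_quotient \<beta>) ?w)"
    have T': "complex_linear (blinfun_apply T)" "blinfun_apply T x = of_real (norm x)"
      using T by (auto simp: support_functionals_def)
    have x': "x \<in> ball 0 1" "x \<noteq> 0" using x by auto
    have w: "?w \<in> ball 0 1"
      using norm_blinfun[of l x] l(2) x' by simp
    have Re: "Re p > \<alpha> * (cmod p)\<^sup>2"
      using koebe_quotient_starlike(2)[OF w \<beta>] by (simp add: \<beta>_def p_def)
    have "inv_deriv_apply F x = p *\<^sub>C x"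
      unfolding F_def[abs_def] p_def by (rule scalar_multiple_inv_deriv_apply[OF ctx x'(1)])
    then have S: "blinfun_apply T (inv_deriv_apply F x) = of_real (norm x) * p"
      by (simp add: complex_linearD(2)[OF T'(1)] T'(2) scaleC_complex_def mult.commute)
    show "if \<alpha> = 0 then Re (blinfun_apply T (inv_deriv_apply F x)) > 0
          else cmod (1 / of_real (norm x) * blinfun_apply T (inv_deriv_apply F x)
                      - 1 / (2 * of_real \<alpha>)) < 1 / (2 * \<alpha>)"
    proof (cases "\<alpha> = 0")
      case True
      then show ?thesis using Re x' by (simp add: S)
    next
      case False
      have "1 / of_real (norm x) * (of_real (norm x) * p) = p" using x' by simp
      then show ?thesis
        unfolding S using False Re \<alpha> cmod_minus_half_less_iff[of \<alpha> p] by simp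
    qed
  qed
  moreover have "A2 F u l * A4 F u l - (A3 F u l)\<^sup>2 = - of_real (\<beta>\<^sup>2)"
    by (simp add: A2_def A3_def A4_def diag fact_numeral complex_linearD(2)[OF l(1)] l(3) scaleC_complex_def)
  then have "cmod (A2 F u l * A4 F u l - (A3 F u l)\<^sup>2) = (1 - \<alpha>)\<^sup>2"
    by (simp add: norm_power \<beta>_def del: of_real_power)
  ultimately show ?thesis using lb u lu by blast
qed

theorem theorem3p2:
  fixes \<alpha> :: real
  assumes "\<exists>x :: 'a::complex_banach. x \<noteq> 0"
    and "0 \<le> \<alpha>" and "\<alpha> < 1"
  shows
    "(\<forall>F :: 'a \<Rightarrow> 'a.
        locally_biholomorphic F \<and> scalar_type_terms F \<and> F \<in> starlike_order \<alpha> \<longrightarrow>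
        (\<forall>x0 T. norm x0 = 1 \<and> T \<in> support_functionals x0 \<longrightarrow>
          cmod (A2 F x0 T * A4 F x0 T - (A3 F x0 T)\<^sup>2) \<le> (1 - \<alpha>)\<^sup>2)) \<and>
     (\<exists>F :: 'a \<Rightarrow> 'a.
        locally_biholomorphic F \<and> scalar_type_terms F \<and> F \<in> starlike_order \<alpha> \<and>
        (\<exists>x0 T. norm x0 = 1 \<and> T \<in> support_functionals x0 \<and>
          cmod (A2 F x0 T * A4 F x0 T - (A3 F x0 T)\<^sup>2) = (1 - \<alpha>)\<^sup>2))"
  using hankel_upper_bound[OF assms(2,3)] hankel_bound_attained[OF assms] by blast

end
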